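(* Let $n\ge 2$ be an integer, let $n_1,n_2\in\{1,\dots,n\}$ with $n_1\le n_2$, and let $\ell_1,\ell_2\in\mathbb{Z}$ be such that the $\mathfrak{sl}(n,\mathbb{F})$-module $\mathscr{H}_{\langle\ell_1,\ell_2\rangle}$ is irreducible. Then $\mathscr{H}_{\langle\ell_1,\ell_2\rangle}$ has the minimal Gelfand-Kirillov dimension $n-1$ if and only if one of the following holds: (1) $n_1<n_2=n$; (2) $n_1=n_2=1$; (3) $n_1=n_2=n-1$.
   Context: The base field $\mathbb{F}$ has characteristic $0$; $\mathbb{N}$ denotes the nonnegative integers; $\overline{i,j}=\{i,i+1,\dots,j\}$ (empty if $i>j$). $E_{i,j}$ is the $n\times n$ matrix unit. Let $\mathscr{B}=\mathbb{F}[x_1,\dots,x_n,y_1,\dots,y_n]$ and fix $n_1,n_2\in\overline{1,n}$ with $n_1\le n_2$. The Lie algebra $\mathfrak{sl}(n,\mathbb{F})$ acts on $\mathscr{B}$ by restricting the action determined by $E_{i,j}|_{\mathscr{B}}=E_{i,j}^x-E_{j,i}^y$ for $i,j\in\overline{1,n}$, where $$E_{i,j}^x=\begin{cases}-x_j\partial_{x_i}-\delta_{i,j}& i,j\in\overline{1,n_1};\\ \partial_{x_i}\partial_{x_j}& i\in\overline{1,n_1},\ j\in\overline{n_1+1,n};\\ -x_ix_j& i\in\overline{n_1+1,n},\ j\in\overline{1,n_1};\\ x_i\partial_{x_j}& i,j\in\overline{n_1+1,n},\end{cases}$$ $$E_{i,j}^y=\begin{cases}y_i\partial_{y_j}& i,j\in\overline{1,n_2};\\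 -y_iy_j& i\in\overline{1,n_2},\ j\in\overline{n_2+1,n};\\ \partial_{y_i}\partial_{y_j}& i\in\overline{n_2+1,n},\ j\in\overline{1,n_2};\\ -y_j\partial_{y_i}-\delta_{i,j}& i,j\in\overline{n_2+1,n}.\end{cases}$$ Set $$\mathscr{D}=-\sum_{i=1}^{n_1}x_i\partial_{y_i}+\sum_{r=n_1+1}^{n_2}\partial_{x_r}\partial_{y_r}-\sum_{s=n_2+1}^{n}y_s\partial_{x_s}.$$ For $\ell_1,\ell_2\in\mathbb{Z}$ let $$\mathscr{B}_{\langle\ell_1,\ell_2\rangle}=\mathrm{Span}\Big\{x^\alpha y^\beta \,\Big|\, \alpha,\beta\in\mathbb{N}^n,\ \sum_{r=n_1+1}^n\alpha_r-\sum_{i=1}^{n_1}\alpha_i=\ell_1,\ \sum_{i=1}^{n_2}\beta_i-\sum_{r=n_2+1}^n\beta_r=\ell_2\Big\},$$ $$\mathscr{H}_{\langle\ell_1,\ell_2\rangle}=\{f\in\mathscr{B}_{\langle\ell_1,\ell_2\rangle}\mid \mathscr{D}(f)=0\},$$ which is an $\mathfrak{sl}(n,\mathbb{F})$-submodule of $\mathscr{B}$. Gelfand-Kirillov dimension: for a $U(\mathfrak{g})$-module $M$ generated by a finite-dimensional subspace $M_0$, with $U_k(\mathfrak{g})$ the span of products of at most $k$ elements of $\mathfrak{g}$, $GKdim(M)=\limsup_{k\to\infty}\frac{\log\dim(U_k(\mathfrak{g})M_0)}{\log k}$ (independent of the choice of $M_0$). For $\mathfrak{sl}(n,\mathbb{F})$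 the smallest Gelfand-Kirillov dimension of an infinite-dimensional irreducible highest-weight module is $n-1$; this is what "minimal Gelfand-Kirillov dimension" means. *)

theory Defs
  imports
    "HOL-Library.Poly_Mapping"
    "HOL-Library.Extended_Real"
    "Jordan_Normal_Form.Matrix"
begin

section \<open>Modules over a set of operators, Gelfand-Kirillov dimension\<close>

text \<open>
  A module structure on (a subspace of) a vector space is given by a set \<open>g\<close>, thought of as
  the underlying set of a Lie algebra, and an action \<open>act\<close> on vectors. Submodules,
  irreducibility and the subspaces \<open>U\<^sub>k(g) M\<^sub>0\<close> depend only on these data: the bracket of
  \<open>g\<close> does not enter.
\<close>

locale operator_module = vector_space scale
  for scale :: "'a::field \<Rightarrow> 'b::ab_group_add \<Rightarrow> 'b" +
  fixes g :: "'g set" and act :: "'g \<Rightarrow> 'b \<Rightarrow> 'b"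
begin

definition lie_submodule :: "'b set \<Rightarrow> bool" where
  "lie_submodule W \<longleftrightarrow> subspace W \<and> (\<forall>A\<in>g. \<forall>w\<in>W. act A w \<in> W)"

definition irreducible_module :: "'b set \<Rightarrow> bool" where
  "irreducible_module M \<longleftrightarrow>
     lie_submodule M \<and> M \<noteq> {0} \<and>
     (\<forall>W. lie_submodule W \<and> W \<subseteq> M \<longrightarrow> W = {0} \<or> W = M)"

text \<open>
  \<open>U\<^sub>k(g) M\<^sub>0\<close>; the list \<open>[A\<^sub>1, \<dots>, A\<^sub>m]\<close> stands for the product \<open>A\<^sub>1 \<cdots> A\<^sub>m\<close> in \<open>U(g)\<close>,
  the empty list for \<open>1\<close>.
\<close>

definition U_filt :: "nat \<Rightarrow> 'b set \<Rightarrow> 'b set" where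
  "U_filt k M0 =
     span {foldr act As v | As v. set As \<subseteq> g \<and> length As \<le> k \<and> v \<in> M0}"

definition fin_dim_generating :: "'b set \<Rightarrow> 'b set \<Rightarrow> bool" where
  "fin_dim_generating M M0 \<longleftrightarrow>
     (\<exists>S. finite S \<and> M0 = span S) \<and> (\<Union>k. U_filt k M0) = M"

text \<open>
  The value does not depend on the generating subspace chosen. It is only meaningful for
  modules that have a finite-dimensional generating subspace; every irreducible module does.
\<close>

definition GKdim :: "'b set \<Rightarrow> ereal" where
  "GKdim M =
     (let M0 = (SOME M0. fin_dim_generating M M0)
      in limsup (\<lambda>k. ereal (ln (real (dim (U_filt k M0))) / ln (real k))))"

end


section \<open>The polynomial algebra in \<open>x\<^sub>1, \<dots>, x\<^sub>n, y\<^sub>1, \<dots>, y\<^sub>n\<close>\<close>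

datatype coord = Xc nat | Yc nat

type_synonym 'a xy_poly = "(coord \<Rightarrow>\<^sub>0 nat) \<Rightarrow>\<^sub>0 'a"

definition pscale :: "'a::comm_ring_1 \<Rightarrow> 'a xy_poly \<Rightarrow> 'a xy_poly" where
  "pscale c f = Poly_Mapping.single 0 c * f"

global_interpretation poly_vs: vector_space "pscale :: 'a::field \<Rightarrow> 'a xy_poly \<Rightarrow> 'a xy_poly"
  by unfold_locales
    (simp_all add: pscale_def algebra_simps single_add mult_single mult.assoc[symmetric])

definition pvar :: "coord \<Rightarrow> 'a::comm_ring_1 xy_poly" where
  "pvar v = Poly_Mapping.single (Poly_Mapping.single v 1) 1"

text \<open>Partial derivative. Subtraction of exponents is truncated, but the terms where this
  matters have coefficient \<open>0\<close>.\<close>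

definition pdiff :: "coord \<Rightarrow> 'a::comm_ring_1 xy_poly \<Rightarrow> 'a xy_poly" where
  "pdiff v f = (\<Sum>m\<in>Poly_Mapping.keys f.
     Poly_Mapping.single (m - Poly_Mapping.single v 1)
       (of_nat (Poly_Mapping.lookup m v) * Poly_Mapping.lookup f m))"

abbreviation mul_x :: "nat \<Rightarrow> 'a::comm_ring_1 xy_poly \<Rightarrow> 'a xy_poly" where
  "mul_x i f \<equiv> pvar (Xc i) * f"

abbreviation mul_y :: "nat \<Rightarrow> 'a::comm_ring_1 xy_poly \<Rightarrow> 'a xy_poly" where
  "mul_y i f \<equiv> pvar (Yc i) * f"

abbreviation d_x :: "nat \<Rightarrow> 'a::comm_ring_1 xy_poly \<Rightarrow> 'a xy_poly" where
  "d_x i f \<equiv> pdiff (Xc i) f"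

abbreviation d_y :: "nat \<Rightarrow> 'a::comm_ring_1 xy_poly \<Rightarrow> 'a xy_poly" where
  "d_y i f \<equiv> pdiff (Yc i) f"


section \<open>The action of \<open>sl(n)\<close>\<close>

text \<open>Indices \<open>i\<close>, \<open>j\<close> range over \<open>{1..n}\<close>.\<close>

definition E_x :: "nat \<Rightarrow> nat \<Rightarrow> nat \<Rightarrow> 'a::comm_ring_1 xy_poly \<Rightarrow> 'a xy_poly" where
  "E_x n1 i j f =
     (if i \<le> n1 \<and> j \<le> n1 then - mul_x j (d_x i f) - (if i = j then f else 0)
      else if i \<le> n1 \<and> n1 < j then d_x i (d_x j f)
      else if n1 < i \<and> j \<le> n1 then - mul_x i (mul_x j f)
      else mul_x i (d_x j f))"

definition E_y :: "nat \<Rightarrow> nat \<Rightarrow> nat \<Rightarrow> 'a::comm_ring_1 xy_poly \<Rightarrow> 'a xy_poly" where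
  "E_y n2 i j f =
     (if i \<le> n2 \<and> j \<le> n2 then mul_y i (d_y j f)
      else if i \<le> n2 \<and> n2 < j then - mul_y i (mul_y j f)
      else if n2 < i \<and> j \<le> n2 then d_y i (d_y j f)
      else - mul_y j (d_y i f) - (if i = j then f else 0))"

definition E_op :: "nat \<Rightarrow> nat \<Rightarrow> nat \<Rightarrow> nat \<Rightarrow> 'a::comm_ring_1 xy_poly \<Rightarrow> 'a xy_poly" where
  "E_op n1 n2 i j f = E_x n1 i j f - E_y n2 j i f"

definition sl_set :: "nat \<Rightarrow> 'a::comm_ring_1 mat set" where
  "sl_set n = {A \<in> carrier_mat n n. (\<Sum>i<n. A $$ (i, i)) = 0}"

text \<open>Entries of type \<open>mat\<close> are indexed from \<open>0\<close>, hence the shift.\<close>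

definition mat_act ::
    "nat \<Rightarrow> nat \<Rightarrow> nat \<Rightarrow> 'a::comm_ring_1 mat \<Rightarrow> 'a xy_poly \<Rightarrow> 'a xy_poly" where
  "mat_act n n1 n2 A f =
     (\<Sum>i\<in>{1..n}. \<Sum>j\<in>{1..n}. pscale (A $$ (i - 1, j - 1)) (E_op n1 n2 i j f))"


global_interpretation sl_mod:
    operator_module "pscale :: 'a::field \<Rightarrow> _" "sl_set n" "mat_act n n1 n2"
  for n n1 n2 ..


section \<open>The modules \<open>\<H>\<^bsub>\<langle>\<ell>\<^sub>1,\<ell>\<^sub>2\<rangle>\<^esub>\<close>\<close>

definition D_op :: "nat \<Rightarrow> nat \<Rightarrow> nat \<Rightarrow> 'a::comm_ring_1 xy_poly \<Rightarrow> 'a xy_poly" where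
  "D_op n n1 n2 f =
     - (\<Sum>i\<in>{1..n1}. mul_x i (d_y i f))
     + (\<Sum>r\<in>{n1+1..n2}. d_x r (d_y r f))
     - (\<Sum>s\<in>{n2+1..n}. mul_y s (d_x s f))"

definition B_space :: "nat \<Rightarrow> nat \<Rightarrow> nat \<Rightarrow> int \<Rightarrow> int \<Rightarrow> 'a::field xy_poly set" where
  "B_space n n1 n2 l1 l2 = poly_vs.span
     {Poly_Mapping.single m 1 | m.
        Poly_Mapping.keys m \<subseteq> Xc ` {1..n} \<union> Yc ` {1..n} \<and>
        (\<Sum>r\<in>{n1+1..n}. int (Poly_Mapping.lookup m (Xc r)))
          - (\<Sum>i\<in>{1..n1}. int (Poly_Mapping.lookup m (Xc i))) = l1 \<and>
        (\<Sum>i\<in>{1..n2}. int (Poly_Mapping.lookup m (Yc i)))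
          - (\<Sum>r\<in>{n2+1..n}. int (Poly_Mapping.lookup m (Yc r))) = l2}"

definition H_space :: "nat \<Rightarrow> nat \<Rightarrow> nat \<Rightarrow> int \<Rightarrow> int \<Rightarrow> 'a::field xy_poly set" where
  "H_space n n1 n2 l1 l2 = {f \<in> B_space n n1 n2 l1 l2. D_op n n1 n2 f = 0}"

end

theory Submission
  imports Defs "HOL-Library.Product_Lexorder" "HOL-Real_Asymp.Real_Asymp"
begin

text \<open>
  Put a total order on the monomials. Suppose that operators \<open>A\<^sub>1, \<dots>, A\<^sub>r\<close> from \<open>sl(n)\<close> multiply
  leading monomials by fixed monomials \<open>\<mu>\<^sub>1, \<dots>, \<mu>\<^sub>r\<close>, and that these are multiplicatively independent.
  Then the vectors \<open>A\<^sub>1\<^bsup>k\<^sub>1\<^esup> \<cdots> A\<^sub>r\<^bsup>k\<^sub>r\<^esup> f\<close> have distinct leading monomials for every \<open>f \<noteq> 0\<close>, so they are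
  linearly independent and the Gelfand-Kirillov dimension is at least \<open>r\<close> (\<open>dim_U_filt_ge\<close>).
  
  For \<open>j \<le> n\<^sub>1 < i\<close> the operator \<open>E\<^sub>i\<^sub>j\<close> is \<open>- x\<^sub>i x\<^sub>j\<close> plus either \<open>y\<^sub>i y\<^sub>j\<close> (if \<open>n\<^sub>2 < i\<close>) or a first order term
  \<open>- y\<^sub>j \<partial>\<^sub>y\<^sub>i\<close>. Think of \<open>x\<^sub>i x\<^sub>j\<close> as an edge between the vertices \<open>i\<close> and \<open>j\<close>; edges of a tree give
  independent monomials. If \<open>n\<^sub>1 < n\<close>, a spanning tree on \<open>{1..n}\<close> has \<open>n - 1\<close> edges of this kind, so the
  dimension is at least \<open>n - 1\<close> (\<open>GKdim_H_ge_tree\<close>). When none of the three conditions holds and \<open>n\<^sub>1 < n\<close>,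
  there is an edge \<open>(p, q)\<close> with \<open>q \<le> n\<^sub>2 < p\<close> outside the tree. The operator \<open>E\<^sub>p\<^sub>q\<close> contains \<open>y\<^sub>p y\<^sub>q\<close>, and a
  weight that makes \<open>y\<^sub>p, y\<^sub>q\<close> heavy and \<open>x\<^sub>p, x\<^sub>q\<close> light turns this term into its leading one without
  changing those of the tree. This is one more independent monomial, and the dimension is at
  least \<open>n\<close> (\<open>GKdim_H_ge_tree_plus_edge\<close>).
  
  Upper bounds come from counting monomials of bounded degree. Each \<open>E\<^sub>i\<^sub>j\<close> raises the degree by at
  most \<open>2\<close>, so it is enough to bound the number of monomials of degree at most \<open>K\<close> that determine an
  element of the module; a bound of order \<open>K\<^bsup>e\<^esup>\<close> gives dimension at most \<open>e\<close> (\<open>GKdim_H_le_card\<close>). If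
  \<open>n\<^sub>2 = n\<close>, the second grading leaves finitely many possibilities for the \<open>y\<close>-part, and the first one
  removes one of the \<open>n\<close> exponents of the \<open>x\<close>-part, so \<open>e = n - 1\<close>. If \<open>n\<^sub>1 = n\<^sub>2 = 1\<close>, the equation
  \<open>\<D> f = 0\<close> reads \<open>x\<^sub>1 \<partial>\<^sub>y\<^sub>1 f = - \<Sum>\<^sub>s y\<^sub>s \<partial>\<^sub>x\<^sub>s f\<close> and forces \<open>f\<close> to be determined by its restriction to
  \<open>y\<^sub>1 = 0\<close> (\<open>kernel_exponent_zero\<close>); after this restriction the same count applies. The case
  \<open>n\<^sub>1 = n\<^sub>2 = n - 1\<close> is the mirror image, with restriction to \<open>x\<^sub>n = 0\<close>. Finally, for \<open>n\<^sub>1 = n\<^sub>2 = n\<close> the two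
  gradings bound all exponents and the module is finite-dimensional.
\<close>

section \<open>Generating subspaces and growth\<close>

context operator_module
begin

lemma U_filt_mono: "k \<le> l \<Longrightarrow> U_filt k M0 \<subseteq> U_filt l M0"
  unfolding U_filt_def by (rule span_mono) (fastforce intro: order_trans)

lemma act_U_filt:
  assumes lin: "Vector_Spaces.linear scale scale (act A)" and A: "A \<in> g" and w: "w \<in> U_filt k M0"
  shows "act A w \<in> U_filt (Suc k) M0"
proof -
  interpret Vector_Spaces.linear scale scale "act A" by (rule lin)
  show ?thesis
    using w unfolding U_filt_def
  proof (induction rule: span_induct_alt)
    case base
    show ?case by (simp add: zero span_zero)
  next
    case (step c x y)
    from step(1) obtain As v where As: "x = foldr act As v" "set As \<subseteq> g" "length As \<le> k" "v \<in> M0"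
      by blast
    have "act A x = foldr act (A # As) v" "set (A # As) \<subseteq> g" "length (A # As) \<le> Suc k"
      using As A by auto
    then have "act A x \<in> span {foldr act As v | As v. set As \<subseteq> g \<and> length As \<le> Suc k \<and> v \<in> M0}"
      using As(4) by (intro span_base) blast
    then show ?case
      using step(2) by (simp add: add scale span_add span_scale)
  qed
qed

lemma U_filt_subset_lie_submodule:
  assumes "lie_submodule M" and "M0 \<subseteq> M"
  shows "U_filt k M0 \<subseteq> M"
proof -
  have "foldr act As v \<in> M" if "set As \<subseteq> g" "v \<in> M0" for As v
    using that assms by (induction As) (auto simp: lie_submodule_def)
  then show ?thesis
    unfolding U_filt_def using assms(1) by (intro span_minimal) (auto simp: lie_submodule_def)
qed

text \<open>
  A nonzero vector of an irreducible module generates it, so \<open>GKdim\<close> really chooses a generating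
  subspace.
\<close>

lemma irreducible_module_generated:
  assumes irr: "irreducible_module M" and lin: "\<And>A. A \<in> g \<Longrightarrow> Vector_Spaces.linear scale scale (act A)"
  shows "\<exists>M0. fin_dim_generating M M0"
proof -
  from irr have M: "lie_submodule M" "M \<noteq> {0}" by (auto simp: irreducible_module_def)
  then have subM: "subspace M" by (auto simp: lie_submodule_def)
  then obtain f where f: "f \<in> M" "f \<noteq> 0" using M subspace_0 by blast
  define W where "W = (\<Union>k. U_filt k (span {f}))"
  have sub: "subspace (U_filt k (span {f}))" for k by (simp add: U_filt_def)
  have "lie_submodule W"
    unfolding lie_submodule_def
  proof (intro conjI ballI subspaceI)
    show "0 \<in> W" using sub subspace_0 by (auto simp: W_def)
    fix x y assume "x \<in> W" "y \<in> W"
    then obtain k l where "x \<in> U_filt k (span {f})" "y \<in> U_filt l (span {f})" by (auto simp: W_def)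
    then have "x + y \<in> U_filt (max k l) (span {f})"
      using U_filt_mono[of k "max k l"] U_filt_mono[of l "max k l"] sub subspace_add
      by (meson max.cobounded1 max.cobounded2 subsetD)
    then show "x + y \<in> W" by (auto simp: W_def)
  next
    fix c x assume "x \<in> W"
    then obtain k where "x \<in> U_filt k (span {f})" by (auto simp: W_def)
    then have "scale c x \<in> U_filt k (span {f})" using sub subspace_scale by blast
    then show "scale c x \<in> W" by (auto simp: W_def)
  next
    fix A w assume "A \<in> g" "w \<in> W"
    then show "act A w \<in> W" using act_U_filt[OF lin] by (force simp: W_def)
  qed
  moreover have "W \<subseteq> M"
    unfolding W_def using f subM M(1)
    by (intro UN_least U_filt_subset_lie_submodule) (auto simp: span_minimal)
  moreover have "f \<in> W"
    unfolding W_def U_filt_def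
    by (intro UN_I[of 0] span_base) (auto intro!: exI[of _ "[]"] exI[of _ f] span_base)
  ultimately have "W = M" using irr f(2) by (auto simp: irreducible_module_def)
  then show ?thesis
    unfolding fin_dim_generating_def W_def by (intro exI[of _ "span {f}"]) auto
qed

lemma fin_dim_generating_GKdim:
  assumes "\<exists>M0. fin_dim_generating M M0"
  obtains M0 where "fin_dim_generating M M0"
    and "GKdim M = limsup (\<lambda>k. ereal (ln (real (dim (U_filt k M0))) / ln (real k)))"
  using someI_ex[OF assms] by (auto simp: GKdim_def Let_def)

text \<open>
  The choice made in the definition of \<open>GKdim\<close> is not accessible, so both growth bounds are
  required for all generating subspaces, with constants that may depend on the subspace.
\<close>

lemma GKdim_le:
  assumes "\<exists>M0. fin_dim_generating M M0"
    and upper: "\<And>M0. fin_dim_generating M M0 \<Longrightarrow>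
      \<exists>C>0. \<forall>k\<ge>1. real (dim (U_filt k M0)) \<le> C * real k ^ e"
  shows "GKdim M \<le> ereal (real e)"
proof -
  obtain M0 where M0: "fin_dim_generating M M0"
    and GK: "GKdim M = limsup (\<lambda>k. ereal (ln (real (dim (U_filt k M0))) / ln (real k)))"
    using assms(1) by (rule fin_dim_generating_GKdim)
  obtain C where C: "C > 0" "\<And>k. k \<ge> 1 \<Longrightarrow> real (dim (U_filt k M0)) \<le> C * real k ^ e"
    using upper[OF M0] by auto
  \<comment> \<open>The absolute value covers the case of dimension \<open>0\<close>, where \<open>ln 0 = 0\<close>.\<close>
  have "ln (real (dim (U_filt k M0))) / ln (real k) \<le> (\<bar>ln C\<bar> + real e * ln (real k)) / ln (real k)"
    if k: "k \<ge> 2" for k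
  proof (rule divide_right_mono)
    show "ln (real (dim (U_filt k M0))) \<le> \<bar>ln C\<bar> + real e * ln (real k)"
    proof (cases "dim (U_filt k M0) = 0")
      case False
      then have "ln (real (dim (U_filt k M0))) \<le> ln (C * real k ^ e)"
        using C(2)[of k] k by (intro ln_mono) auto
      also have "\<dots> = ln C + real e * ln (real k)"
        using C(1) k by (simp add: ln_mult ln_realpow)
      finally show ?thesis by linarith
    qed (use k in auto)
  qed (use k in auto)
  then have "limsup (\<lambda>k. ereal (ln (real (dim (U_filt k M0))) / ln (real k)))
      \<le> limsup (\<lambda>k. ereal ((\<bar>ln C\<bar> + real e * ln (real k)) / ln (real k)))"
    by (intro Limsup_mono) (auto simp: eventually_at_top_linorder)
  also have "\<dots> = ereal (real e)"
  proof (rule lim_imp_Limsup)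
    have "(\<lambda>k. (\<bar>ln C\<bar> + real e * ln (real k)) / ln (real k)) \<longlonglongrightarrow> real e"
      by real_asymp
    then show "(\<lambda>k. ereal ((\<bar>ln C\<bar> + real e * ln (real k)) / ln (real k))) \<longlonglongrightarrow> ereal (real e)"
      by (simp add: lim_ereal)
  qed simp
  finally show ?thesis using GK by simp
qed

lemma GKdim_ge:
  assumes "\<exists>M0. fin_dim_generating M M0"
    and lower: "\<And>M0. fin_dim_generating M M0 \<Longrightarrow>
      \<exists>c>0. \<forall>k\<ge>1. c * real k ^ e \<le> real (dim (U_filt k M0))"
  shows "ereal (real e) \<le> GKdim M"
proof -
  obtain M0 where M0: "fin_dim_generating M M0"
    and GK: "GKdim M = limsup (\<lambda>k. ereal (ln (real (dim (U_filt k M0))) / ln (real k)))"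
    using assms(1) by (rule fin_dim_generating_GKdim)
  obtain c where c: "c > 0" "\<And>k. k \<ge> 1 \<Longrightarrow> c * real k ^ e \<le> real (dim (U_filt k M0))"
    using lower[OF M0] by auto
  have "(ln c + real e * ln (real k)) / ln (real k) \<le> ln (real (dim (U_filt k M0))) / ln (real k)"
    if k: "k \<ge> 2" for k
  proof (rule divide_right_mono)
    have "ln c + real e * ln (real k) = ln (c * real k ^ e)"
      using c(1) k by (simp add: ln_mult ln_realpow)
    also have "\<dots> \<le> ln (real (dim (U_filt k M0)))"
      using c k by (intro ln_mono) auto
    finally show "ln c + real e * ln (real k) \<le> ln (real (dim (U_filt k M0)))" .
  qed (use k in auto)
  then have "limsup (\<lambda>k. ereal ((ln c + real e * ln (real k)) / ln (real k)))
      \<le> limsup (\<lambda>k. ereal (ln (real (dim (U_filt k M0))) / ln (real k)))"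
    by (intro Limsup_mono) (auto simp: eventually_at_top_linorder)
  moreover have "limsup (\<lambda>k. ereal ((ln c + real e * ln (real k)) / ln (real k))) = ereal (real e)"
  proof (rule lim_imp_Limsup)
    have "(\<lambda>k. (ln c + real e * ln (real k)) / ln (real k)) \<longlonglongrightarrow> real e"
      by real_asymp
    then show "(\<lambda>k. ereal ((ln c + real e * ln (real k)) / ln (real k))) \<longlonglongrightarrow> ereal (real e)"
      by (simp add: lim_ereal)
  qed simp
  ultimately show ?thesis using GK by simp
qed

end


section \<open>Coefficients, weights and linear algebra of polynomials\<close>

lemma lookup_pscale: "Poly_Mapping.lookup (pscale c f) m = c * Poly_Mapping.lookup f m"
proof -
  have "Poly_Mapping.lookup (Poly_Mapping.single 0 c * f) (0 + m) = c * Poly_Mapping.lookup f m"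
    by (simp add: lookup_mult lookup_single when_mult)
  then show ?thesis by (simp add: pscale_def)
qed

lemma lookup_single_mult:
  fixes a :: "coord \<Rightarrow>\<^sub>0 nat"
  shows "Poly_Mapping.lookup (Poly_Mapping.single a c * f) (m + a) = c * Poly_Mapping.lookup f m"
proof -
  have "(m + a = a + q) = (q = m)" for q by (metis add.commute add_left_imp_eq)
  then show ?thesis
    by (simp add: lookup_mult lookup_single when_mult)
qed

lemma keys_single_mult:
  fixes a :: "coord \<Rightarrow>\<^sub>0 nat"
  assumes "m \<in> Poly_Mapping.keys (Poly_Mapping.single a c * f)"
  obtains m' where "m' \<in> Poly_Mapping.keys f" "m = m' + a"
  using subsetD[OF keys_mult assms] by (auto split: if_splits simp: add.commute)

lemma lookup_pdiff:
  "Poly_Mapping.lookup (pdiff v f) m =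
     of_nat (Poly_Mapping.lookup m v + 1) * Poly_Mapping.lookup f (m + Poly_Mapping.single v 1)"
proof -
  have shift: "m' - Poly_Mapping.single v 1 = m \<longleftrightarrow> m' = m + Poly_Mapping.single v 1"
    if "Poly_Mapping.lookup m' v \<noteq> 0" for m'
  proof
    assume "m' - Poly_Mapping.single v 1 = m"
    moreover have "m' - Poly_Mapping.single v 1 + Poly_Mapping.single v 1 = m'"
      using that by (intro poly_mapping_eqI) (auto simp: lookup_add lookup_minus lookup_single when_def)
    ultimately show "m' = m + Poly_Mapping.single v 1" by simp
  qed simp
  have "Poly_Mapping.lookup (pdiff v f) m =
      (\<Sum>m'\<in>Poly_Mapping.keys f. of_nat (Poly_Mapping.lookup m' v) * Poly_Mapping.lookup f m'
          when m' - Poly_Mapping.single v 1 = m)"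
    by (simp add: pdiff_def lookup_sum lookup_single)
  also have "\<dots> = (\<Sum>m'\<in>Poly_Mapping.keys f.
      if m' = m + Poly_Mapping.single v 1
      then of_nat (Poly_Mapping.lookup m' v) * Poly_Mapping.lookup f m' else 0)"
  proof (rule sum.cong)
    fix m' show "(of_nat (Poly_Mapping.lookup m' v) * Poly_Mapping.lookup f m'
        when m' - Poly_Mapping.single v 1 = m) =
      (if m' = m + Poly_Mapping.single v 1
        then of_nat (Poly_Mapping.lookup m' v) * Poly_Mapping.lookup f m' else 0)"
      using shift[of m'] by (cases "Poly_Mapping.lookup m' v = 0") (auto simp: when_def)
  qed simp
  also have "\<dots> = of_nat (Poly_Mapping.lookup m v + 1) *
      Poly_Mapping.lookup f (m + Poly_Mapping.single v 1)"
    by (simp add: in_keys_iff lookup_add)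
  finally show ?thesis .
qed

lemma pdiff_add: "pdiff v (f + g) = pdiff v f + pdiff v g"
  by (rule poly_mapping_eqI) (simp add: lookup_pdiff lookup_add algebra_simps)

lemma pdiff_pscale: "pdiff v (pscale c f) = pscale c (pdiff v f)"
  by (rule poly_mapping_eqI) (simp add: lookup_pdiff lookup_pscale algebra_simps)

lemma pscale_mult_right: "g * pscale c f = pscale c (g * f)"
  by (simp add: pscale_def mult.left_commute)

text \<open>
  Integer weights serve three purposes: weight \<open>1\<close> on all variables is the total degree, special
  weights single out leading terms, and weight \<open>- 1\<close> on one variable turns lower bounds for the
  exponent of that variable into upper bounds.
\<close>

definition wt :: "(coord \<Rightarrow> int) \<Rightarrow> (coord \<Rightarrow>\<^sub>0 nat) \<Rightarrow> int" where
  "wt w m = (\<Sum>c\<in>Poly_Mapping.keys m. w c * int (Poly_Mapping.lookup m c))"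

lemma wt_superset:
  assumes "finite S" "Poly_Mapping.keys m \<subseteq> S"
  shows "wt w m = (\<Sum>c\<in>S. w c * int (Poly_Mapping.lookup m c))"
  unfolding wt_def using assms by (intro sum.mono_neutral_left) (auto simp: in_keys_iff)

lemma wt_add: "wt w (m + m') = wt w m + wt w m'"
proof -
  let ?S = "Poly_Mapping.keys m \<union> Poly_Mapping.keys m'"
  have "wt w (m + m') = (\<Sum>c\<in>?S. w c * int (Poly_Mapping.lookup (m + m') c))"
    using keys_add[of m m'] by (intro wt_superset) auto
  also have "\<dots> = (\<Sum>c\<in>?S. w c * int (Poly_Mapping.lookup m c))
      + (\<Sum>c\<in>?S. w c * int (Poly_Mapping.lookup m' c))"
    by (simp add: lookup_add algebra_simps sum.distrib)
  also have "\<dots> = wt w m + wt w m'"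
    by (simp add: wt_superset[of ?S m] wt_superset[of ?S m'])
  finally show ?thesis .
qed

lemma wt_single: "wt w (Poly_Mapping.single v k) = w v * int k"
  by (simp add: wt_def)

definition wt_le :: "(coord \<Rightarrow> int) \<Rightarrow> int \<Rightarrow> 'a::comm_ring_1 xy_poly \<Rightarrow> bool" where
  "wt_le w N f \<longleftrightarrow> (\<forall>m\<in>Poly_Mapping.keys f. wt w m \<le> N)"

lemma wt_le_mono: "wt_le w N f \<Longrightarrow> N \<le> N' \<Longrightarrow> wt_le w N' f"
  by (force simp: wt_le_def)

lemma wt_le_0: "wt_le w N 0"
  by (simp add: wt_le_def)

lemma wt_le_add: "wt_le w N f \<Longrightarrow> wt_le w N g \<Longrightarrow> wt_le w N (f + g)"
  using keys_add[of f g] by (auto simp: wt_le_def)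

lemma wt_le_uminus: "wt_le w N f \<Longrightarrow> wt_le w N (- f)"
  by (simp add: wt_le_def)

lemma wt_le_diff: "wt_le w N f \<Longrightarrow> wt_le w N g \<Longrightarrow> wt_le w N (f - g)"
  using keys_diff[of f g] by (auto simp: wt_le_def)

lemma wt_le_sum: "(\<And>i. i \<in> I \<Longrightarrow> wt_le w N (F i)) \<Longrightarrow> wt_le w N (\<Sum>i\<in>I. F i)"
  by (induction I rule: infinite_finite_induct) (auto simp: wt_le_0 wt_le_add)

lemma wt_le_pscale: "wt_le w N f \<Longrightarrow> wt_le w N (pscale c f)"
  by (auto simp: wt_le_def in_keys_iff lookup_pscale)

lemma wt_le_pvar: "wt_le w N f \<Longrightarrow> wt_le w (N + w v) (pvar v * f)"
  by (auto simp: wt_le_def pvar_def wt_add wt_single elim!: keys_single_mult)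

lemma wt_le_pdiff: "wt_le w N f \<Longrightarrow> wt_le w (N - w v) (pdiff v f)"
proof -
  assume f: "wt_le w N f"
  have "wt w m \<le> N - w v" if "m \<in> Poly_Mapping.keys (pdiff v f)" for m
  proof -
    have "m + Poly_Mapping.single v 1 \<in> Poly_Mapping.keys f"
      using that by (auto simp: in_keys_iff lookup_pdiff)
    then have "wt w (m + Poly_Mapping.single v 1) \<le> N" using f by (auto simp: wt_le_def)
    then show ?thesis by (simp add: wt_add wt_single)
  qed
  then show ?thesis by (simp add: wt_le_def)
qed

text \<open>
  If the coefficients at \<open>T\<close> determine the elements of \<open>V\<close>, then taking these coefficients is an
  injective linear map into a space with basis \<open>T\<close>.
\<close>

lemma card_independent_le_separating:
  fixes V :: "'a::field xy_poly set"
  assumes V: "poly_vs.subspace V" and T: "finite T"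
    and sep: "\<And>f. f \<in> V \<Longrightarrow> (\<forall>m\<in>T. Poly_Mapping.lookup f m = 0) \<Longrightarrow> f = 0"
    and B: "B \<subseteq> V" "poly_vs.independent B"
  shows "finite B \<and> card B \<le> card T"
proof -
  interpret P: vector_space_pair "pscale :: 'a \<Rightarrow> 'a xy_poly \<Rightarrow> _" "pscale :: 'a \<Rightarrow> 'a xy_poly \<Rightarrow> _" ..
  define restr :: "'a xy_poly \<Rightarrow> 'a xy_poly" where
    "restr f = (\<Sum>m\<in>T. pscale (Poly_Mapping.lookup f m) (Poly_Mapping.single m 1))" for f
  have lin: "Vector_Spaces.linear pscale pscale restr"
    unfolding Vector_Spaces.linear_iff
  proof (intro conjI allI)
    show "restr (f + g) = restr f + restr g" for f g
      by (simp add: restr_def lookup_add poly_vs.scale_left_distrib sum.distrib)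
    show "restr (pscale c f) = pscale c (restr f)" for c f
      by (simp add: restr_def lookup_pscale poly_vs.scale_sum_right)
  qed unfold_locales
  have lookup_restr: "Poly_Mapping.lookup (restr f) m = Poly_Mapping.lookup f m" if "m \<in> T" for f m
    using that T
    by (simp add: restr_def lookup_sum lookup_pscale lookup_single when_def if_distrib cong: if_cong)
  have spanB: "poly_vs.span B \<subseteq> V" using B(1) V by (rule poly_vs.span_minimal)
  have inj: "inj_on restr (poly_vs.span B)"
  proof (rule inj_onI)
    fix f g assume fg: "f \<in> poly_vs.span B" "g \<in> poly_vs.span B" "restr f = restr g"
    then have "f - g \<in> V" using spanB poly_vs.span_diff by blast
    moreover have "Poly_Mapping.lookup (f - g) m = 0" if "m \<in> T" for m
      using lookup_restr[OF that, of f] lookup_restr[OF that, of g] fg(3) by (simp add: lookup_minus)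
    ultimately show "f = g" using sep[of "f - g"] by auto
  qed
  have "restr ` B \<subseteq> poly_vs.span ((\<lambda>m. Poly_Mapping.single m 1) ` T)"
    unfolding restr_def
    by (intro image_subsetI poly_vs.span_sum poly_vs.span_scale poly_vs.span_base imageI)
  moreover have "poly_vs.independent (restr ` B)"
    using P.linear_independent_injective_image[OF lin B(2) inj] .
  ultimately have "finite (restr ` B) \<and> card (restr ` B) \<le> card ((\<lambda>m. Poly_Mapping.single m (1::'a)) ` T)"
    using T by (intro poly_vs.independent_span_bound) auto
  moreover have "inj_on restr B" using inj poly_vs.span_superset inj_on_subset by blast
  ultimately show ?thesis
    using card_image_le[OF T, of "\<lambda>m. Poly_Mapping.single m (1::'a)"]
    by (auto simp: card_image finite_image_iff)
qed

lemma dim_le_card_separating: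
  fixes V :: "'a::field xy_poly set"
  assumes "poly_vs.subspace V" "finite T"
    and "\<And>f. f \<in> V \<Longrightarrow> (\<forall>m\<in>T. Poly_Mapping.lookup f m = 0) \<Longrightarrow> f = 0"
  shows "poly_vs.dim V \<le> card T"
  using card_independent_le_separating[OF assms] poly_vs.basis_exists[of V] by metis

lemma card_independent_le_dim:
  fixes V :: "'a::field xy_poly set"
  assumes "poly_vs.subspace V" "finite T"
    and "\<And>f. f \<in> V \<Longrightarrow> (\<forall>m\<in>T. Poly_Mapping.lookup f m = 0) \<Longrightarrow> f = 0"
    and B: "B \<subseteq> V" "poly_vs.independent B"
  shows "card B \<le> poly_vs.dim V"
proof -
  obtain D where D: "D \<subseteq> V" "poly_vs.independent D" "V \<subseteq> poly_vs.span D" "card D = poly_vs.dim V"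
    by (rule poly_vs.basis_exists)
  have "finite D" using card_independent_le_separating[OF assms(1-3) D(1,2)] by simp
  then show ?thesis using poly_vs.independent_span_bound[of D B] B D by auto
qed


section \<open>Leading monomials\<close>

text \<open>
  Any linear order on the variables would do: it makes the monomials an ordered monoid under the
  lexicographic order of finitely supported functions, which is used below to break ties between
  monomials of equal weight.
\<close>

instantiation coord :: linorder
begin

fun coord_code :: "coord \<Rightarrow> nat" where
  "coord_code (Xc i) = 2 * i"
| "coord_code (Yc i) = 2 * i + 1"

definition less_eq_coord :: "coord \<Rightarrow> coord \<Rightarrow> bool" where
  "less_eq_coord c d \<longleftrightarrow> coord_code c \<le> coord_code d"

definition less_coord :: "coord \<Rightarrow> coord \<Rightarrow> bool" where
  "less_coord c d \<longleftrightarrow> coord_code c < coord_code d"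

instance
proof
  fix c d :: coord
  assume "c \<le> d" "d \<le> c"
  then have "coord_code c = coord_code d" by (simp add: less_eq_coord_def)
  then show "c = d" by (cases c; cases d) (auto, presburger+)
qed (auto simp: less_eq_coord_def less_coord_def)

end

definition order_key :: "(coord \<Rightarrow> int) \<Rightarrow> (coord \<Rightarrow>\<^sub>0 nat) \<Rightarrow> int \<times> (coord \<Rightarrow>\<^sub>0 nat)" where
  "order_key w m = (wt w m, m)"

lemma order_key_inject: "order_key w m = order_key w m' \<longleftrightarrow> m = m'"
  by (auto simp: order_key_def)

lemma order_key_add_mono: "order_key w m \<le> order_key w m' \<Longrightarrow> order_key w (m + a) \<le> order_key w (m' + a)"
  by (auto simp: order_key_def wt_add add_right_mono)

definition leads :: "(coord \<Rightarrow> int) \<Rightarrow> 'a::comm_ring_1 xy_poly \<Rightarrow> (coord \<Rightarrow>\<^sub>0 nat) \<Rightarrow> bool" where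
  "leads w f m \<longleftrightarrow> m \<in> Poly_Mapping.keys f \<and> (\<forall>m'\<in>Poly_Mapping.keys f. order_key w m' \<le> order_key w m)"

lemma leads_exists:
  assumes "f \<noteq> 0"
  shows "\<exists>m. leads w f m"
proof -
  let ?K = "order_key w ` Poly_Mapping.keys f"
  have "Max ?K \<in> ?K" using assms by (intro Max_in) auto
  then obtain m where m: "m \<in> Poly_Mapping.keys f" "order_key w m = Max ?K" by force
  then have "\<forall>m'\<in>Poly_Mapping.keys f. order_key w m' \<le> order_key w m" by auto
  then show ?thesis using m(1) by (auto simp: leads_def)
qed

lemma leads_unique: "leads w f m \<Longrightarrow> leads w f m' \<Longrightarrow> m = m'"
  using order_antisym[of "order_key w m" "order_key w m'"] by (auto simp: leads_def order_key_inject)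

lemma leads_wt_le: "leads w f m \<Longrightarrow> wt_le w (wt w m) f"
  by (auto simp: leads_def wt_le_def order_key_def)

text \<open>
  In a linear relation, the largest leading monomial among the vectors with nonzero coefficient
  occurs in one of these vectors only, so it cannot cancel.
\<close>

lemma independent_distinct_leads:
  fixes P :: "'a::field xy_poly set"
  assumes ex: "\<And>f. f \<in> P \<Longrightarrow> \<exists>m. leads w f m"
    and dist: "\<And>f g m. f \<in> P \<Longrightarrow> g \<in> P \<Longrightarrow> leads w f m \<Longrightarrow> leads w g m \<Longrightarrow> f = g"
  shows "poly_vs.independent P"
proof
  assume "poly_vs.dependent P"
  then obtain S u where S: "finite S" "S \<subseteq> P" "\<exists>f\<in>S. u f \<noteq> 0" "(\<Sum>f\<in>S. pscale (u f) f) = 0"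
    unfolding poly_vs.dependent_explicit by blast
  obtain L where L: "\<And>f. f \<in> P \<Longrightarrow> leads w f (L f)" using ex by metis
  define S' where "S' = {f \<in> S. u f \<noteq> 0}"
  have S': "finite S'" "S' \<noteq> {}" "S' \<subseteq> P" using S by (auto simp: S'_def)
  let ?K = "(\<lambda>f. order_key w (L f)) ` S'"
  have "Max ?K \<in> ?K" using S' by (intro Max_in) auto
  then obtain f where f: "f \<in> S'" "order_key w (L f) = Max ?K" by force
  have zero: "u g * Poly_Mapping.lookup g (L f) = 0" if g: "g \<in> S - {f}" for g
  proof (rule ccontr)
    assume "u g * Poly_Mapping.lookup g (L f) \<noteq> 0"
    then have g': "g \<in> S'" "L f \<in> Poly_Mapping.keys g" using g by (auto simp: S'_def in_keys_iff)
    then have "order_key w (L f) \<le> order_key w (L g)" using L[of g] S' by (auto simp: leads_def)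
    moreover have "order_key w (L g) \<le> order_key w (L f)" using f(2) g'(1) S'(1) by auto
    ultimately have "L f = L g" by (metis order_key_inject order_antisym)
    then show False using dist[of f g "L f"] L[of f] L[of g] S' f(1) g g' by auto
  qed
  have "0 = (\<Sum>g\<in>S. u g * Poly_Mapping.lookup g (L f))"
    using arg_cong[OF S(4), of "\<lambda>h. Poly_Mapping.lookup h (L f)"]
    by (simp add: lookup_sum lookup_pscale)
  also have "\<dots> = u f * Poly_Mapping.lookup f (L f)"
    using zero S(1) f(1)
    by (subst sum.remove[of S f]) (auto simp: S'_def intro!: sum.neutral simp del: mult_eq_0_iff)
  finally show False using f(1) L[of f] S' by (auto simp: S'_def leads_def in_keys_iff)
qed

text \<open>
  This is how symbols are recognised: an operator that is multiplication by a monomial \<open>a\<close>, up to a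
  term that raises the weight by less than the weight of \<open>a\<close>, multiplies leading monomials by \<open>a\<close>.
\<close>

lemma leads_multiple_plus_lower:
  fixes f :: "'a::field xy_poly"
  assumes f: "leads w f m" and c: "c \<noteq> 0"
    and R: "wt_le w N R" and N: "N < wt w m + wt w a"
  shows "leads w (pscale c (Poly_Mapping.single a 1 * f) + R) (m + a)"
proof -
  let ?g = "pscale c (Poly_Mapping.single a 1 * f) + R"
  have "m + a \<notin> Poly_Mapping.keys R" using R N by (auto simp: wt_le_def wt_add)
  then have "Poly_Mapping.lookup ?g (m + a) = c * Poly_Mapping.lookup f m"
    by (simp add: lookup_add lookup_pscale lookup_single_mult in_keys_iff)
  then have "m + a \<in> Poly_Mapping.keys ?g" using f c by (simp add: in_keys_iff leads_def)
  moreover have "order_key w m' \<le> order_key w (m + a)" if "m' \<in> Poly_Mapping.keys ?g" for m'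
  proof (cases "m' \<in> Poly_Mapping.keys R")
    case True
    then have "wt w m' < wt w (m + a)" using R N by (auto simp: wt_le_def wt_add)
    then show ?thesis by (simp add: order_key_def)
  next
    case False
    then have "m' \<in> Poly_Mapping.keys (Poly_Mapping.single a 1 * f)"
      using that by (auto simp: in_keys_iff lookup_add lookup_pscale)
    then obtain m'' where "m'' \<in> Poly_Mapping.keys f" "m' = m'' + a" by (rule keys_single_mult)
    then show ?thesis using f by (auto simp: leads_def intro: order_key_add_mono)
  qed
  ultimately show ?thesis by (auto simp: leads_def)
qed


section \<open>Words in operators with multiplicatively independent symbols\<close>

text \<open>
  The word \<open>x\<^sub>1\<^bsup>k\<^sub>1\<^esup> \<cdots> x\<^sub>r\<^bsup>k\<^sub>r\<^esup>\<close>. Applied to a list of exponent vectors, its \<open>sum_list\<close> is the linear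
  combination with coefficients \<open>k\<^sub>1, \<dots>, k\<^sub>r\<close>.
\<close>

definition word :: "nat list \<Rightarrow> 'b list \<Rightarrow> 'b list" where
  "word ks xs = concat (map2 replicate ks xs)"

lemma word_Cons [simp]: "word (k # ks) (x # xs) = replicate k x @ word ks xs"
  by (simp add: word_def)

lemma word_Nil [simp]: "word [] xs = []" "word ks [] = []"
  by (simp_all add: word_def)

lemma map_word: "map h (word ks xs) = word ks (map h xs)"
proof (induction xs arbitrary: ks)
  case (Cons x xs)
  then show ?case by (cases ks) auto
qed simp

lemma set_word: "set (word ks xs) \<subseteq> set xs"
proof (induction xs arbitrary: ks)
  case (Cons x xs)
  then show ?case by (cases ks) (auto simp: set_replicate_conv_if)
qed simp

lemma length_word: "set ks \<subseteq> {..q} \<Longrightarrow> length (word ks xs) \<le> q * length xs"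
proof (induction xs arbitrary: ks)
  case (Cons x xs)
  then show ?case
  proof (cases ks)
    case Nil
    then show ?thesis by simp
  next
    case (Cons k ks')
    then show ?thesis using Cons.IH[of ks'] Cons.prems by auto
  qed
qed simp

text \<open>
  A sufficient condition for multiplicative independence: each monomial contains a pivot variable
  that is absent from all later ones, so exponents can be read off one after the other.
\<close>

fun triangular :: "(coord \<Rightarrow>\<^sub>0 nat) list \<Rightarrow> bool" where
  "triangular [] = True"
| "triangular (a # as) =
    ((\<exists>v. Poly_Mapping.lookup a v \<noteq> 0 \<and> (\<forall>b\<in>set as. Poly_Mapping.lookup b v = 0)) \<and> triangular as)"

lemma triangular_append_single:
  assumes "a \<noteq> 0" and "distinct cs"
    and "\<And>c. c \<in> set cs \<Longrightarrow> Poly_Mapping.lookup (b c) (v c) \<noteq> 0"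
    and "\<And>c. c \<in> set cs \<Longrightarrow> Poly_Mapping.lookup a (v c) = 0"
    and "\<And>c d. c \<in> set cs \<Longrightarrow> d \<in> set cs \<Longrightarrow> c \<noteq> d \<Longrightarrow> Poly_Mapping.lookup (b d) (v c) = 0"
  shows "triangular (map b cs @ [a])"
  using assms(2-)
proof (induction cs)
  case Nil
  obtain u where "Poly_Mapping.lookup a u \<noteq> 0"
    using assms(1) poly_mapping_eqI[of a 0] by auto
  then show ?case by auto
next
  case (Cons c cs)
  have "triangular (map b cs @ [a])"
    by (rule Cons.IH) (use Cons.prems in simp_all)
  moreover have "Poly_Mapping.lookup d (v c) = 0" if "d \<in> set (map b cs @ [a])" for d
    using that Cons.prems by fastforce
  moreover have "Poly_Mapping.lookup (b c) (v c) \<noteq> 0"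
    using Cons.prems(2) by simp
  ultimately show ?case by (simp only: list.map append_Cons triangular.simps) blast
qed

lemma lookup_sum_list_replicate:
  "Poly_Mapping.lookup (sum_list (replicate k a)) v = k * Poly_Mapping.lookup a v"
  by (induction k) (auto simp: lookup_add)

lemma lookup_sum_list_eq_0:
  "(\<And>a. a \<in> set as \<Longrightarrow> Poly_Mapping.lookup a v = 0) \<Longrightarrow> Poly_Mapping.lookup (sum_list as) v = 0"
  by (induction as) (auto simp: lookup_add)

lemma triangular_word_inject:
  fixes as :: "(coord \<Rightarrow>\<^sub>0 nat) list"
  assumes "triangular as" "length ks = length as" "length ls = length as"
    and "sum_list (word ks as) = sum_list (word ls as)"
  shows "ks = ls"
  using assms
proof (induction as arbitrary: ks ls)
  case (Cons a as)
  from Cons.prems(2) obtain k ks' where k: "ks = k # ks'" "length ks' = length as"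
    by (cases ks) simp_all
  from Cons.prems(3) obtain l ls' where l: "ls = l # ls'" "length ls' = length as"
    by (cases ls) simp_all
  have "\<exists>v. Poly_Mapping.lookup a v \<noteq> 0 \<and> (\<forall>b\<in>set as. Poly_Mapping.lookup b v = 0)"
    using Cons.prems(1) by simp
  then obtain v where v: "Poly_Mapping.lookup a v \<noteq> 0" "\<forall>b\<in>set as. Poly_Mapping.lookup b v = 0"
    by blast
  have rest: "Poly_Mapping.lookup (sum_list (word js as)) v = 0" for js
    using v(2) set_word[of js as] by (intro lookup_sum_list_eq_0) blast
  have sums: "sum_list (replicate k a) + sum_list (word ks' as) =
      sum_list (replicate l a) + sum_list (word ls' as)"
    using Cons.prems(4) by (simp add: k l)
  have "k * Poly_Mapping.lookup a v = l * Poly_Mapping.lookup a v"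
    using arg_cong[OF sums, of "\<lambda>b. Poly_Mapping.lookup b v"]
    by (simp only: lookup_add rest lookup_sum_list_replicate add_0_right)
  then have "k = l" using v(1) by simp
  moreover have "ks' = ls'"
    using sums Cons.prems(1) by (intro Cons.IH k l) (simp_all add: \<open>k = l\<close>)
  ultimately show ?case by (simp add: k l)
qed simp

lemma leads_foldr:
  assumes "\<And>A a f m. (A, a) \<in> set ps \<Longrightarrow> leads w f m \<Longrightarrow> leads w (act A f) (m + a)"
    and "leads w f m"
  shows "leads w (foldr act (map fst ps) f) (m + sum_list (map snd ps))"
  using assms
proof (induction ps)
  case (Cons p ps)
  have "leads w (foldr act (map fst ps) f) (m + sum_list (map snd ps))"
  proof (rule Cons.IH)
    show "leads w (act A h) (k + a)" if "(A, a) \<in> set ps" "leads w h k" for A a h k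
      by (rule Cons.prems(1)) (use that in auto)
  qed (rule Cons.prems(2))
  then have "leads w (act (fst p) (foldr act (map fst ps) f)) (m + sum_list (map snd ps) + snd p)"
    by (rule Cons.prems(1)[rotated]) simp
  then show ?case by (simp add: add_ac)
qed simp

text \<open>
  Words with exponents at most \<open>k div r\<close> have length at most \<open>k\<close>. The set \<open>T\<close> ensures that
  \<open>U\<^sub>k(g) M\<^sub>0\<close> is finite-dimensional; for an infinite-dimensional space \<open>dim\<close> would be \<open>0\<close>.
\<close>

lemma dim_U_filt_ge:
  fixes ps :: "('a::field mat \<times> (coord \<Rightarrow>\<^sub>0 nat)) list"
  assumes sl: "fst ` set ps \<subseteq> sl_set n"
    and tri: "triangular (map snd ps)"
    and sym: "\<And>A a h m. (A, a) \<in> set ps \<Longrightarrow> leads w h m \<Longrightarrow> leads w (mat_act n n1 n2 A h) (m + a)"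
    and f: "(f :: 'a xy_poly) \<in> M0" "f \<noteq> 0"
    and T: "finite T"
    and sep: "\<And>h. h \<in> sl_mod.U_filt n n1 n2 k M0 \<Longrightarrow> (\<forall>m\<in>T. Poly_Mapping.lookup h m = 0) \<Longrightarrow> h = 0"
  shows "(k div length ps + 1) ^ length ps \<le> poly_vs.dim (sl_mod.U_filt n n1 n2 k M0)"
proof -
  let ?r = "length ps" let ?q = "k div ?r"
  define I where "I = {ks. set ks \<subseteq> {..?q} \<and> length ks = ?r}"
  define F where "F ks = foldr (mat_act n n1 n2) (word ks (map fst ps)) f" for ks
  obtain m where m: "leads w f m" using leads_exists[OF f(2)] by blast
  have F_leads: "leads w (F ks) (m + sum_list (word ks (map snd ps)))" for ks
  proof -
    have "leads w (foldr (mat_act n n1 n2) (map fst (word ks ps)) f) (m + sum_list (map snd (word ks ps)))"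
    proof (rule leads_foldr[OF _ m])
      fix A a m' and h :: "'a xy_poly" assume "(A, a) \<in> set (word ks ps)" "leads w h m'"
      then show "leads w (mat_act n n1 n2 A h) (m' + a)" using set_word[of ks ps] sym by blast
    qed
    then show ?thesis by (simp add: F_def map_word)
  qed
  have eq: "ks = ls" if "ks \<in> I" "ls \<in> I" "leads w (F ks) a" "leads w (F ls) a" for ks ls a
  proof (rule triangular_word_inject[OF tri])
    show "sum_list (word ks (map snd ps)) = sum_list (word ls (map snd ps))"
      using leads_unique[OF F_leads that(3)] leads_unique[OF F_leads that(4)] by (metis add_left_imp_eq)
  qed (use that in \<open>auto simp: I_def\<close>)
  have inj: "inj_on F I"
    by (rule inj_onI) (metis eq F_leads)
  have "card (F ` I) \<le> poly_vs.dim (sl_mod.U_filt n n1 n2 k M0)"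
  proof (rule card_independent_le_dim[OF _ T sep])
    show "poly_vs.subspace (sl_mod.U_filt n n1 n2 k M0)"
      by (simp add: sl_mod.U_filt_def)
    show "F ` I \<subseteq> sl_mod.U_filt n n1 n2 k M0"
    proof
      fix h assume "h \<in> F ` I"
      then obtain ks where ks: "ks \<in> I" "h = F ks" by blast
      have "length (word ks (map fst ps)) \<le> k"
        using order_trans[OF length_word[of ks ?q "map fst ps"], of k] ks(1)
        by (simp add: I_def)
      moreover have "set (word ks (map fst ps)) \<subseteq> sl_set n"
        using set_word[of ks "map fst ps"] sl by auto
      ultimately show "h \<in> sl_mod.U_filt n n1 n2 k M0"
        unfolding sl_mod.U_filt_def ks(2) F_def using f(1) by (intro poly_vs.span_base) blast
    qed
    show "poly_vs.independent (F ` I)"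
      by (rule independent_distinct_leads[where w = w]) (use F_leads eq in auto)
  qed
  moreover have "card (F ` I) = (?q + 1) ^ ?r"
    by (simp add: card_image[OF inj]) (simp add: I_def card_lists_length_eq)
  ultimately show ?thesis by simp
qed

section \<open>The operators of the oscillator representation\<close>

lemma E_op_add: "E_op n1 n2 i j (f + g) = E_op n1 n2 i j f + E_op n1 n2 i j g"
  by (simp add: E_op_def E_x_def E_y_def pdiff_add algebra_simps)

lemma E_op_pscale:
  "E_op n1 n2 i j (pscale c f) = pscale c (E_op n1 n2 i j (f :: 'a::field xy_poly))"
  by (simp add: E_op_def E_x_def E_y_def pdiff_pscale pscale_mult_right
      poly_vs.scale_right_diff_distrib)

lemma linear_mat_act:
  "Vector_Spaces.linear pscale pscale (mat_act n n1 n2 (A :: 'a::field mat))"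
  unfolding Vector_Spaces.linear_iff
proof (intro conjI allI)
  show "mat_act n n1 n2 A (f + g) = mat_act n n1 n2 A f + mat_act n n1 n2 A g" for f g
    by (simp add: mat_act_def E_op_add poly_vs.scale_right_distrib sum.distrib)
  show "mat_act n n1 n2 A (pscale c f) = pscale c (mat_act n n1 n2 A f)" for c f
    by (simp add: mat_act_def E_op_pscale poly_vs.scale_sum_right mult.commute)
qed unfold_locales

definition mat_unit :: "nat \<Rightarrow> nat \<Rightarrow> nat \<Rightarrow> 'a::comm_ring_1 mat" where
  "mat_unit n i j = mat n n (\<lambda>(a, b). if a = i - 1 \<and> b = j - 1 then 1 else 0)"

lemma mat_unit_in_sl_set:
  assumes "i \<in> {1..n}" "j \<in> {1..n}" "i \<noteq> j"
  shows "mat_unit n i j \<in> sl_set n"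
proof -
  have "i - 1 \<noteq> j - 1" using assms by auto
  then have "(\<Sum>a<n. mat_unit n i j $$ (a, a)) = (0 :: 'a)"
    by (intro sum.neutral) (auto simp: mat_unit_def)
  then show ?thesis by (simp add: sl_set_def mat_unit_def)
qed

lemma mat_act_mat_unit:
  fixes f :: "'a::field xy_poly"
  assumes "i \<in> {1..n}" "j \<in> {1..n}"
  shows "mat_act n n1 n2 (mat_unit n i j) f = E_op n1 n2 i j f"
proof -
  have "pscale (mat_unit n i j $$ (a - 1, b - 1)) (E_op n1 n2 a b f) =
      (if a = i then if b = j then E_op n1 n2 a b f else 0 else 0)"
    if "a \<in> {1..n}" "b \<in> {1..n}" for a b
    using that assms by (auto simp: mat_unit_def)
  then have "mat_act n n1 n2 (mat_unit n i j) f =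
      (\<Sum>a\<in>{1..n}. \<Sum>b\<in>{1..n}. if a = i then if b = j then E_op n1 n2 a b f else 0 else 0)"
    unfolding mat_act_def by (intro sum.cong) auto
  also have "\<dots> = (\<Sum>a\<in>{1..n}. if a = i then E_op n1 n2 i j f else 0)"
    using assms by (intro sum.cong) auto
  also have "\<dots> = E_op n1 n2 i j f"
    using assms by simp
  finally show ?thesis .
qed

abbreviation deg_le :: "int \<Rightarrow> 'a::comm_ring_1 xy_poly \<Rightarrow> bool" where
  "deg_le \<equiv> wt_le (\<lambda>_. 1)"

lemma deg_le_mult:
  assumes "deg_le N f"
  shows "deg_le (N + 1) (pvar v * f)" and "deg_le (N - 1) (pdiff v f)"
  using wt_le_pvar[OF assms] wt_le_pdiff[OF assms] by auto

lemma deg_le_E_op: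
  assumes f: "deg_le N f"
  shows "deg_le (N + 2) (E_op n1 n2 i j f)"
proof -
  have xx: "deg_le (N + 2) (pvar u * (pvar v * f))" for u v
    by (rule wt_le_mono[OF deg_le_mult(1)[OF deg_le_mult(1)[OF f]]]) simp
  have xd: "deg_le (N + 2) (pvar u * pdiff v f)" for u v
    by (rule wt_le_mono[OF deg_le_mult(1)[OF deg_le_mult(2)[OF f]]]) simp
  have dd: "deg_le (N + 2) (pdiff u (pdiff v f))" for u v
    by (rule wt_le_mono[OF deg_le_mult(2)[OF deg_le_mult(2)[OF f]]]) simp
  have f': "deg_le (N + 2) f"
    using f by (rule wt_le_mono) simp
  show ?thesis
    unfolding E_op_def E_x_def E_y_def
    by (auto intro!: wt_le_diff wt_le_uminus xx xd dd f' wt_le_0 simp del: diff_minus_eq_add)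
qed

lemma deg_le_mat_act: "deg_le N f \<Longrightarrow> deg_le (N + 2) (mat_act n n1 n2 A f)"
  unfolding mat_act_def by (intro wt_le_sum wt_le_pscale deg_le_E_op)

lemma subspace_wt_le: "poly_vs.subspace {f. wt_le w N f}"
  by (auto simp: poly_vs.subspace_def wt_le_0 wt_le_add wt_le_pscale)

lemma U_filt_deg_le:
  fixes M0 :: "'a::field xy_poly set"
  assumes "sl_mod.fin_dim_generating n n1 n2 M M0"
  shows "\<exists>d::nat. \<forall>k. \<forall>f \<in> sl_mod.U_filt n n1 n2 k M0. deg_le (int (d + 2 * k)) f"
proof -
  obtain S where S: "finite S" "M0 = poly_vs.span S"
    using assms by (auto simp: sl_mod.fin_dim_generating_def)
  define E where "E = wt (\<lambda>_. 1) ` (\<Union>f\<in>S. Poly_Mapping.keys f)"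
  define d where "d = nat (Max (insert 0 E))"
  have "finite E" using S(1) by (simp add: E_def)
  then have "e \<le> int d" if "e \<in> E" for e
    using that by (auto simp: d_def)
  then have "deg_le (int d) f" if "f \<in> S" for f
    using that by (auto simp: wt_le_def E_def)
  then have M0: "M0 \<subseteq> {f. deg_le (int d) f}"
    unfolding S(2) by (intro poly_vs.span_minimal subspace_wt_le) auto
  have word: "deg_le (N + 2 * int (length As)) (foldr (mat_act n n1 n2) As v)"
    if "deg_le N v" for N and As :: "'a mat list" and v
    using that
  proof (induction As)
    case (Cons A As)
    then show ?case using deg_le_mat_act[of "N + 2 * int (length As)"] by (simp add: algebra_simps)
  qed simp
  have "foldr (mat_act n n1 n2) As v \<in> {f. deg_le (int (d + 2 * k)) f}"
    if "length As \<le> k" "v \<in> M0" for k v and As :: "'a mat list"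
  proof -
    have "deg_le (int d + 2 * int (length As)) (foldr (mat_act n n1 n2) As v)"
      using M0 that(2) by (intro word) auto
    then show ?thesis using that(1) by (auto elim: wt_le_mono)
  qed
  then have "sl_mod.U_filt n n1 n2 k M0 \<subseteq> {f. deg_le (int (d + 2 * k)) f}" for k
    unfolding sl_mod.U_filt_def by (intro poly_vs.span_minimal subspace_wt_le) blast
  then show ?thesis by blast
qed

text \<open>
  For \<open>j \<le> n\<^sub>1 < i\<close> the operator \<open>E\<^sub>i\<^sub>j\<close> equals \<open>- x\<^sub>i x\<^sub>j - y\<^sub>j \<partial>\<^sub>y\<^sub>i\<close> if \<open>i \<le> n\<^sub>2\<close>, and \<open>- x\<^sub>i x\<^sub>j + y\<^sub>i y\<^sub>j\<close> otherwise.
\<close>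

lemma leads_E_op_x_pair:
  fixes f :: "'a::field xy_poly"
  assumes ij: "j \<le> n1" "n1 < i" "n1 \<le> n2"
    and low: "i \<le> n2 \<Longrightarrow> w (Yc j) - w (Yc i) < w (Xc i) + w (Xc j)"
    and high: "n2 < i \<Longrightarrow> w (Yc j) + w (Yc i) < w (Xc i) + w (Xc j)"
    and f: "leads w f m"
  shows "leads w (E_op n1 n2 i j f) (m + (Poly_Mapping.single (Xc i) 1 + Poly_Mapping.single (Xc j) 1))"
proof -
  let ?a = "Poly_Mapping.single (Xc i) 1 + Poly_Mapping.single (Xc j) 1 :: coord \<Rightarrow>\<^sub>0 nat"
  let ?R = "if i \<le> n2 then - mul_y j (d_y i f) else mul_y j (mul_y i f)"
  let ?N = "if i \<le> n2 then wt w m - w (Yc i) + w (Yc j) else wt w m + w (Yc i) + w (Yc j)"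
  have "E_op n1 n2 i j f = pscale (- 1) (Poly_Mapping.single ?a 1 * f) + ?R"
    using ij by (auto simp: E_op_def E_x_def E_y_def pvar_def mult_single mult.assoc[symmetric])
  moreover have "wt_le w ?N ?R"
    using leads_wt_le[OF f] by (auto intro!: wt_le_uminus wt_le_pvar wt_le_pdiff)
  moreover have "?N < wt w m + wt w ?a"
    using low high by (auto simp: wt_add wt_single)
  ultimately show ?thesis
    using leads_multiple_plus_lower[OF f, of "- 1" ?N ?R ?a] by simp
qed

text \<open>
  For \<open>q \<le> n\<^sub>2 < p\<close> the operator \<open>E\<^sub>p\<^sub>q\<close> equals \<open>y\<^sub>p y\<^sub>q - x\<^sub>p x\<^sub>q\<close> if \<open>q \<le> n\<^sub>1\<close>, and \<open>y\<^sub>p y\<^sub>q + x\<^sub>p \<partial>\<^sub>x\<^sub>q\<close> otherwise.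
\<close>

lemma leads_E_op_y_pair:
  fixes f :: "'a::field xy_poly"
  assumes pq: "q \<le> n2" "n2 < p" "n1 \<le> n2"
    and low: "q \<le> n1 \<Longrightarrow> w (Xc p) + w (Xc q) < w (Yc p) + w (Yc q)"
    and high: "n1 < q \<Longrightarrow> w (Xc p) - w (Xc q) < w (Yc p) + w (Yc q)"
    and f: "leads w f m"
  shows "leads w (E_op n1 n2 p q f) (m + (Poly_Mapping.single (Yc p) 1 + Poly_Mapping.single (Yc q) 1))"
proof -
  let ?a = "Poly_Mapping.single (Yc p) 1 + Poly_Mapping.single (Yc q) 1 :: coord \<Rightarrow>\<^sub>0 nat"
  let ?R = "if q \<le> n1 then - mul_x p (mul_x q f) else mul_x p (d_x q f)"
  let ?N = "if q \<le> n1 then wt w m + w (Xc q) + w (Xc p) else wt w m - w (Xc q) + w (Xc p)"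
  have "E_op n1 n2 p q f = pscale 1 (Poly_Mapping.single ?a 1 * f) + ?R"
    using pq by (auto simp: E_op_def E_x_def E_y_def pvar_def mult_single mult.assoc[symmetric] add.commute)
  moreover have "wt_le w ?N ?R"
    using leads_wt_le[OF f] by (auto intro!: wt_le_uminus wt_le_pvar wt_le_pdiff)
  moreover have "?N < wt w m + wt w ?a"
    using low high by (auto simp: wt_add wt_single)
  ultimately show ?thesis
    using leads_multiple_plus_lower[OF f, of 1 ?N ?R ?a] by simp
qed


section \<open>Counting monomials\<close>

text \<open>
  Only the exponents in \<open>P\<close> may grow with \<open>K\<close>, so the number of monomials is of order \<open>K\<^bsup>card P\<^esup>\<close>.
\<close>

lemma card_monomials_le:
  fixes T :: "(coord \<Rightarrow>\<^sub>0 nat) set"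
  assumes fin: "finite P" "finite Q"
    and P: "\<And>m c. m \<in> T \<Longrightarrow> c \<in> P \<Longrightarrow> Poly_Mapping.lookup m c \<le> K"
    and Q: "\<And>m c. m \<in> T \<Longrightarrow> c \<in> Q \<Longrightarrow> Poly_Mapping.lookup m c \<le> L"
    and eq: "\<And>m m'. m \<in> T \<Longrightarrow> m' \<in> T \<Longrightarrow>
      (\<And>c. c \<in> P \<union> Q \<Longrightarrow> Poly_Mapping.lookup m c = Poly_Mapping.lookup m' c) \<Longrightarrow> m = m'"
  shows "finite T \<and> card T \<le> (K + 1) ^ card P * (L + 1) ^ card Q"
proof -
  define F where "F m = (restrict (Poly_Mapping.lookup m) P, restrict (Poly_Mapping.lookup m) Q)"
    for m :: "coord \<Rightarrow>\<^sub>0 nat"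
  let ?B = "(P \<rightarrow>\<^sub>E {..K}) \<times> (Q \<rightarrow>\<^sub>E {..L})"
  have "inj_on F T"
  proof (rule inj_onI)
    fix m m' assume m: "m \<in> T" "m' \<in> T" "F m = F m'"
    show "m = m'"
    proof (rule eq[OF m(1,2)])
      fix c assume "c \<in> P \<union> Q"
      then show "Poly_Mapping.lookup m c = Poly_Mapping.lookup m' c"
        using m(3) unfolding F_def prod.inject by (metis Un_iff restrict_apply')
    qed
  qed
  moreover have "F ` T \<subseteq> ?B" using P Q by (auto simp: F_def)
  moreover have "finite ?B" using fin by (intro finite_cartesian_product finite_PiE) auto
  moreover have "card ?B = (K + 1) ^ card P * (L + 1) ^ card Q"
    using fin by (simp add: card_cartesian_product card_PiE)
  ultimately show ?thesis
    by (metis card_image card_mono finite_imageD finite_subset)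
qed

lemma lookup_le_degree: "int (Poly_Mapping.lookup m c) \<le> wt (\<lambda>_. 1) m"
proof (cases "c \<in> Poly_Mapping.keys m")
  case True
  then show ?thesis
    unfolding wt_def using member_le_sum[of c "Poly_Mapping.keys m" "\<lambda>c. 1 * int (Poly_Mapping.lookup m c)"]
    by simp
next
  case False
  then show ?thesis by (simp add: wt_def in_keys_iff sum_nonneg)
qed

definition B_monomials :: "nat \<Rightarrow> nat \<Rightarrow> nat \<Rightarrow> int \<Rightarrow> int \<Rightarrow> (coord \<Rightarrow>\<^sub>0 nat) set" where
  "B_monomials n n1 n2 l1 l2 = {m.
     Poly_Mapping.keys m \<subseteq> Xc ` {1..n} \<union> Yc ` {1..n} \<and>
     (\<Sum>r\<in>{n1+1..n}. int (Poly_Mapping.lookup m (Xc r)))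
       - (\<Sum>i\<in>{1..n1}. int (Poly_Mapping.lookup m (Xc i))) = l1 \<and>
     (\<Sum>i\<in>{1..n2}. int (Poly_Mapping.lookup m (Yc i)))
       - (\<Sum>r\<in>{n2+1..n}. int (Poly_Mapping.lookup m (Yc r))) = l2}"

lemma keys_B_space:
  fixes f :: "'a::field xy_poly"
  assumes "f \<in> B_space n n1 n2 l1 l2"
  shows "Poly_Mapping.keys f \<subseteq> B_monomials n n1 n2 l1 l2"
proof -
  have "poly_vs.subspace {g :: 'a xy_poly. Poly_Mapping.keys g \<subseteq> B_monomials n n1 n2 l1 l2}"
    unfolding poly_vs.subspace_def
  proof (intro conjI ballI allI)
    fix g h :: "'a xy_poly"
    assume "g \<in> {g. Poly_Mapping.keys g \<subseteq> B_monomials n n1 n2 l1 l2}"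
      "h \<in> {g. Poly_Mapping.keys g \<subseteq> B_monomials n n1 n2 l1 l2}"
    then show "g + h \<in> {g. Poly_Mapping.keys g \<subseteq> B_monomials n n1 n2 l1 l2}"
      using keys_add[of g h] by auto
  next
    fix c and g :: "'a xy_poly"
    assume "g \<in> {g. Poly_Mapping.keys g \<subseteq> B_monomials n n1 n2 l1 l2}"
    then show "pscale c g \<in> {g. Poly_Mapping.keys g \<subseteq> B_monomials n n1 n2 l1 l2}"
      by (auto simp: in_keys_iff lookup_pscale subset_iff)
  qed simp
  then have "B_space n n1 n2 l1 l2 \<subseteq> {g :: 'a xy_poly. Poly_Mapping.keys g \<subseteq> B_monomials n n1 n2 l1 l2}"
    unfolding B_space_def by (intro poly_vs.span_minimal) (auto simp: B_monomials_def)
  then show ?thesis using assms by auto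
qed

lemma B_monomials_lookup_eq_0:
  assumes "m \<in> B_monomials n n1 n2 l1 l2" "c \<notin> Xc ` {1..n} \<union> Yc ` {1..n}"
  shows "Poly_Mapping.lookup m c = 0"
  using assms by (auto simp: B_monomials_def in_keys_iff subset_iff)

text \<open>
  Consider a monomial \<open>m\<close> of \<open>f\<close> in which the exponent \<open>e\<close> of \<open>v\<close> is minimal. If \<open>e > 0\<close>, then \<open>u \<partial>\<^sub>v f\<close> contains
  \<open>m u / v\<close> with coefficient \<open>e\<close> times that of \<open>m\<close>, which is nonzero in characteristic \<open>0\<close>. In this monomial \<open>v\<close> has
  exponent \<open>e - 1\<close>. The operator behind \<open>R\<close> does not lower exponents of \<open>v\<close>, so \<open>R\<close> cannot cancel it.
\<close>

lemma kernel_exponent_zero: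
  fixes f R :: "'a::field_char_0 xy_poly"
  assumes ker: "pvar u * pdiff v f + R = 0" and uv: "u \<noteq> v" and f: "f \<noteq> 0"
    and R: "\<And>N. wt_le (\<lambda>c. if c = v then - 1 else 0) N f \<Longrightarrow> wt_le (\<lambda>c. if c = v then - 1 else 0) N R"
  shows "\<exists>m\<in>Poly_Mapping.keys f. Poly_Mapping.lookup m v = 0"
proof (rule ccontr)
  assume pos: "\<not> ?thesis"
  let ?w = "\<lambda>c. if c = v then - 1 else (0 :: int)"
  have wt_v: "wt ?w m = - int (Poly_Mapping.lookup m v)" for m
  proof -
    have "wt ?w m = (\<Sum>c\<in>insert v (Poly_Mapping.keys m). ?w c * int (Poly_Mapping.lookup m c))"
      by (intro wt_superset) auto
    also have "\<dots> = (\<Sum>c\<in>insert v (Poly_Mapping.keys m). if c = v then - int (Poly_Mapping.lookup m v) else 0)"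
      by (intro sum.cong) auto
    finally show ?thesis by simp
  qed
  obtain m where m: "m \<in> Poly_Mapping.keys f"
    "\<And>m'. m' \<in> Poly_Mapping.keys f \<Longrightarrow> Poly_Mapping.lookup m v \<le> Poly_Mapping.lookup m' v"
    using f ex_has_least_nat[of "\<lambda>m. m \<in> Poly_Mapping.keys f" _ "\<lambda>m. Poly_Mapping.lookup m v"]
    by (metis all_not_in_conv keys_eq_empty)
  define m0 where "m0 = m - Poly_Mapping.single v 1"
  have mv: "Poly_Mapping.lookup m v \<noteq> 0" using pos m(1) by auto
  then have m0: "m = m0 + Poly_Mapping.single v 1"
    unfolding m0_def by (intro poly_mapping_eqI) (auto simp: lookup_add lookup_minus lookup_single when_def)
  have "Poly_Mapping.lookup (pvar u * pdiff v f) (m0 + Poly_Mapping.single u 1) =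
      of_nat (Poly_Mapping.lookup m0 v + 1) * Poly_Mapping.lookup f m"
    unfolding pvar_def lookup_single_mult lookup_pdiff m0 by simp
  moreover have "\<dots> \<noteq> 0"
    using m(1) by (simp add: in_keys_iff del: of_nat_add of_nat_Suc)
  moreover have "Poly_Mapping.lookup (pvar u * pdiff v f) (m0 + Poly_Mapping.single u 1)
      + Poly_Mapping.lookup R (m0 + Poly_Mapping.single u 1) = 0"
    by (metis ker lookup_add lookup_zero)
  ultimately have "m0 + Poly_Mapping.single u 1 \<in> Poly_Mapping.keys R"
    by (auto simp: in_keys_iff)
  moreover have "wt_le ?w (- int (Poly_Mapping.lookup m v)) R"
    by (rule R) (use m(2) in \<open>auto simp: wt_le_def wt_v\<close>)
  ultimately have "Poly_Mapping.lookup m v \<le> Poly_Mapping.lookup (m0 + Poly_Mapping.single u 1) v"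
    by (auto simp: wt_le_def wt_v)
  then show False using uv mv by (simp add: m0 lookup_add lookup_single)
qed

section \<open>Bounds for the growth of the modules\<close>

text \<open>
  The set \<open>Z\<close> consists of monomials that suffice to detect nonzero elements of \<open>H\<close>. On \<open>Z\<close> the exponents
  in \<open>Q\<close> are bounded, those in \<open>P\<close> are limited only by the degree, and all others are functions of these.
\<close>

lemma GKdim_H_le_card:
  fixes H :: "'a::field_char_0 xy_poly set" and Z :: "(coord \<Rightarrow>\<^sub>0 nat) set"
  assumes irr: "sl_mod.irreducible_module n n1 n2 H"
    and fin: "finite P" "finite Q"
    and sep: "\<And>f. f \<in> H \<Longrightarrow> f \<noteq> 0 \<Longrightarrow> \<exists>m\<in>Poly_Mapping.keys f. m \<in> Z"
    and Q: "\<And>m c. m \<in> Z \<Longrightarrow> c \<in> Q \<Longrightarrow> Poly_Mapping.lookup m c \<le> L"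
    and eq: "\<And>m m'. m \<in> Z \<Longrightarrow> m' \<in> Z \<Longrightarrow>
      (\<And>c. c \<in> P \<union> Q \<Longrightarrow> Poly_Mapping.lookup m c = Poly_Mapping.lookup m' c) \<Longrightarrow> m = m'"
  shows "sl_mod.GKdim n n1 n2 H \<le> ereal (real (card P))"
proof (rule sl_mod.GKdim_le)
  show "\<exists>M0. sl_mod.fin_dim_generating n n1 n2 H M0"
    by (rule sl_mod.irreducible_module_generated[OF irr linear_mat_act])
next
  fix M0 assume M0: "sl_mod.fin_dim_generating n n1 n2 H M0"
  obtain d :: nat where d: "\<And>k f. f \<in> sl_mod.U_filt n n1 n2 k M0 \<Longrightarrow> deg_le (int (d + 2 * k)) f"
    using U_filt_deg_le[OF M0] by blast
  define C where "C = real ((d + 3) ^ card P * (L + 1) ^ card Q)"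
  have "real (poly_vs.dim (sl_mod.U_filt n n1 n2 k M0)) \<le> C * real k ^ card P" if k: "k \<ge> 1" for k
  proof -
    define T where "T = {m \<in> Z. wt (\<lambda>_. 1) m \<le> int (d + 2 * k)}"
    have T: "finite T \<and> card T \<le> (d + 2 * k + 1) ^ card P * (L + 1) ^ card Q"
    proof (rule card_monomials_le[OF fin])
      fix m c assume "m \<in> T"
      then show "Poly_Mapping.lookup m c \<le> d + 2 * k"
        using lookup_le_degree[of m c] by (simp add: T_def)
    next
      fix m c assume "m \<in> T" "c \<in> Q"
      then show "Poly_Mapping.lookup m c \<le> L" using Q by (simp add: T_def)
    next
      fix m m' assume "m \<in> T" "m' \<in> T"
        "\<And>c. c \<in> P \<union> Q \<Longrightarrow> Poly_Mapping.lookup m c = Poly_Mapping.lookup m' c"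
      then show "m = m'" using eq by (simp add: T_def)
    qed
    have "poly_vs.dim (sl_mod.U_filt n n1 n2 k M0) \<le> card T"
    proof (rule dim_le_card_separating)
      show "poly_vs.subspace (sl_mod.U_filt n n1 n2 k M0)" by (simp add: sl_mod.U_filt_def)
      show "finite T" using T by simp
      fix f assume f: "f \<in> sl_mod.U_filt n n1 n2 k M0" "\<forall>m\<in>T. Poly_Mapping.lookup f m = 0"
      have "f \<in> H" using f(1) M0 by (auto simp: sl_mod.fin_dim_generating_def)
      then show "f = 0"
        using sep[of f] f(2) d[OF f(1)] by (auto simp: T_def wt_le_def in_keys_iff)
    qed
    also have "\<dots> \<le> (d + 2 * k + 1) ^ card P * (L + 1) ^ card Q" using T by simp
    also have "\<dots> \<le> ((d + 3) * k) ^ card P * (L + 1) ^ card Q"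
    proof -
      have "d + 2 * k + 1 \<le> (d + 3) * k"
        using mult_le_mono2[OF k, of "d + 1"] by (simp add: algebra_simps)
      then show ?thesis by (intro mult_le_mono1 power_mono) auto
    qed
    finally have "real (poly_vs.dim (sl_mod.U_filt n n1 n2 k M0))
        \<le> real (((d + 3) * k) ^ card P * (L + 1) ^ card Q)"
      by (rule of_nat_mono)
    then show ?thesis by (simp add: C_def power_mult_distrib mult_ac)
  qed
  moreover have "C > 0" by (simp add: C_def)
  ultimately show "\<exists>C>0. \<forall>k\<ge>1. real (poly_vs.dim (sl_mod.U_filt n n1 n2 k M0)) \<le> C * real k ^ card P"
    by blast
qed

lemma B_monomials_eqI:
  assumes "m \<in> B_monomials n n1 n2 l1 l2" "m' \<in> B_monomials n n1 n2 l1 l2"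
    and "\<And>i. i \<in> {1..n} \<Longrightarrow> Poly_Mapping.lookup m (Xc i) = Poly_Mapping.lookup m' (Xc i)"
    and "\<And>i. i \<in> {1..n} \<Longrightarrow> Poly_Mapping.lookup m (Yc i) = Poly_Mapping.lookup m' (Yc i)"
  shows "m = m'"
proof (rule poly_mapping_eqI)
  fix c show "Poly_Mapping.lookup m c = Poly_Mapping.lookup m' c"
    using B_monomials_lookup_eq_0[OF assms(1), of c] B_monomials_lookup_eq_0[OF assms(2), of c] assms(3,4)
    by (cases "c \<in> Xc ` {1..n} \<union> Yc ` {1..n}") auto
qed

text \<open>
  Every generating subspace contains some \<open>f \<noteq> 0\<close>, to which words in the operators can be applied.
\<close>

lemma GKdim_H_ge_length:
  fixes H :: "'a::field_char_0 xy_poly set" and ps :: "('a mat \<times> (coord \<Rightarrow>\<^sub>0 nat)) list"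
  assumes irr: "sl_mod.irreducible_module n n1 n2 H" and H: "H = H_space n n1 n2 l1 l2"
    and sl: "fst ` set ps \<subseteq> sl_set n"
    and tri: "triangular (map snd ps)"
    and sym: "\<And>A a m (h :: 'a xy_poly).
      (A, a) \<in> set ps \<Longrightarrow> leads w h m \<Longrightarrow> leads w (mat_act n n1 n2 A h) (m + a)"
  shows "ereal (real (length ps)) \<le> sl_mod.GKdim n n1 n2 H"
proof (rule sl_mod.GKdim_ge)
  show "\<exists>M0. sl_mod.fin_dim_generating n n1 n2 H M0"
    by (rule sl_mod.irreducible_module_generated[OF irr linear_mat_act])
next
  fix M0 assume M0: "sl_mod.fin_dim_generating n n1 n2 H M0"
  let ?r = "length ps"
  obtain d :: nat where d: "\<And>k f. f \<in> sl_mod.U_filt n n1 n2 k M0 \<Longrightarrow> deg_le (int (d + 2 * k)) f"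
    using U_filt_deg_le[OF M0] by blast
  obtain f where f: "f \<in> M0" "f \<noteq> 0"
  proof (rule ccontr)
    assume "\<not> thesis"
    then have "M0 \<subseteq> {0 :: 'a xy_poly}" using that by blast
    moreover have "mat_act n n1 n2 A 0 = 0" for A :: "'a mat"
      using linear_mat_act[of n n1 n2 A] by (metis module_hom.zero Vector_Spaces.linear.axioms(3))
    then have "sl_mod.lie_submodule n n1 n2 {0 :: 'a xy_poly}"
      by (simp add: sl_mod.lie_submodule_def poly_vs.subspace_single_0)
    ultimately have "sl_mod.U_filt n n1 n2 k M0 \<subseteq> {0}" for k
      by (intro sl_mod.U_filt_subset_lie_submodule)
    then have "H \<subseteq> {0}" using M0 by (auto simp: sl_mod.fin_dim_generating_def)
    moreover have "0 \<in> H" "H \<noteq> {0}" using irr poly_vs.subspace_0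
      by (auto simp: sl_mod.irreducible_module_def sl_mod.lie_submodule_def)
    ultimately show False by blast
  qed
  have "(1 / real ?r) ^ ?r * real k ^ ?r \<le> real (poly_vs.dim (sl_mod.U_filt n n1 n2 k M0))"
    if "k \<ge> 1" for k
  proof -
    define T where "T = {m \<in> B_monomials n n1 n2 l1 l2. wt (\<lambda>_. 1) m \<le> int (d + 2 * k)}"
    have T: "finite T"
    proof (rule conjunct1[OF card_monomials_le])
      show "finite (Xc ` {1..n} \<union> Yc ` {1..n})" "finite ({} :: coord set)" by auto
      fix m c assume "m \<in> T"
      then show "Poly_Mapping.lookup m c \<le> d + 2 * k"
        using lookup_le_degree[of m c] by (simp add: T_def)
    next
      fix m m' assume "m \<in> T" "m' \<in> T"
        "\<And>c. c \<in> Xc ` {1..n} \<union> Yc ` {1..n} \<union> {} \<Longrightarrow> Poly_Mapping.lookup m c = Poly_Mapping.lookup m' c"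
      then show "m = m'" by (intro B_monomials_eqI) (auto simp: T_def)
    qed auto
    have "(k div ?r + 1) ^ ?r \<le> poly_vs.dim (sl_mod.U_filt n n1 n2 k M0)"
    proof (rule dim_U_filt_ge[OF sl tri sym f T])
      fix h assume h: "h \<in> sl_mod.U_filt n n1 n2 k M0" "\<forall>m\<in>T. Poly_Mapping.lookup h m = 0"
      have "h \<in> H" using h(1) M0 by (auto simp: sl_mod.fin_dim_generating_def)
      then have "Poly_Mapping.keys h \<subseteq> B_monomials n n1 n2 l1 l2"
        using keys_B_space[of h n n1 n2 l1 l2] by (auto simp: H H_space_def)
      then have "Poly_Mapping.keys h \<subseteq> T" using d[OF h(1)] by (auto simp: T_def wt_le_def)
      then show "h = 0"
        using h(2) by (intro poly_mapping_eqI) (metis in_keys_iff lookup_zero subsetD)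
    qed
    then have "real ((k div ?r + 1) ^ ?r) \<le> real (poly_vs.dim (sl_mod.U_filt n n1 n2 k M0))"
      by (rule of_nat_mono)
    moreover have "(1 / real ?r) ^ ?r * real k ^ ?r \<le> real ((k div ?r + 1) ^ ?r)"
    proof (cases "?r = 0")
      case False
      have "k < ?r * (k div ?r + 1)" using False dividend_less_times_div[of ?r k] by simp
      then have "real k \<le> real ?r * real (k div ?r + 1)"
        by (metis less_imp_le of_nat_le_iff of_nat_mult)
      then have "1 / real ?r * real k \<le> real (k div ?r + 1)"
        using False by (simp add: divide_simps mult.commute)
      then have "(1 / real ?r * real k) ^ ?r \<le> real (k div ?r + 1) ^ ?r"
        by (intro power_mono) auto
      then show ?thesis by (simp only: power_mult_distrib of_nat_power)
    qed simp
    ultimately show ?thesis by linarith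
  qed
  moreover have "(1 / real ?r) ^ ?r > 0" by (cases "?r = 0") auto
  ultimately show "\<exists>c>0. \<forall>k\<ge>1. c * real k ^ ?r \<le> real (poly_vs.dim (sl_mod.U_filt n n1 n2 k M0))"
    by blast
qed

text \<open>
  The edges for \<open>1 \<le> c < n\<close> form a spanning tree of \<open>{1..n}\<close>: the vertices \<open>2, \<dots>, n\<^sub>1\<close> hang from \<open>n\<close>, the
  vertices \<open>n\<^sub>1 + 1, \<dots>, n - 1\<close> hang from \<open>1\<close>, and \<open>c = 1\<close> is the edge \<open>(n, 1)\<close>. Each edge joins some
  \<open>i > n\<^sub>1\<close> to some \<open>j \<le> n\<^sub>1\<close>.
\<close>

definition tree_edge :: "nat \<Rightarrow> nat \<Rightarrow> nat \<Rightarrow> nat \<times> nat" where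
  "tree_edge n n1 c = (if c \<le> n1 then (n, c) else (c, 1))"

definition x_pair :: "nat \<times> nat \<Rightarrow> coord \<Rightarrow>\<^sub>0 nat" where
  "x_pair e = Poly_Mapping.single (Xc (fst e)) 1 + Poly_Mapping.single (Xc (snd e)) 1"

definition y_pair :: "nat \<times> nat \<Rightarrow> coord \<Rightarrow>\<^sub>0 nat" where
  "y_pair e = Poly_Mapping.single (Yc (fst e)) 1 + Poly_Mapping.single (Yc (snd e)) 1"

text \<open>
  The edge \<open>(n, 1)\<close> comes last: for \<open>c \<ge> 2\<close> the vertex \<open>c\<close> is a leaf, so \<open>x\<^sub>c\<close> serves as a pivot.
\<close>

definition tree_ops :: "nat \<Rightarrow> nat \<Rightarrow> ('a::field mat \<times> (coord \<Rightarrow>\<^sub>0 nat)) list" where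
  "tree_ops n n1 = map (\<lambda>c. let e = tree_edge n n1 c in (mat_unit n (fst e) (snd e), x_pair e)) ([2..<n] @ [1])"

text \<open>
  For \<open>S = {p, q}\<close>, the monomial \<open>y\<^sub>p y\<^sub>q\<close> has weight \<open>4\<close> and \<open>x\<^sub>p x\<^sub>q\<close> weight \<open>2\<close>. If at most one of \<open>i, j\<close> is in
  \<open>S\<close>, then \<open>x\<^sub>i x\<^sub>j\<close> has weight at least \<open>3\<close> and \<open>y\<^sub>i y\<^sub>j\<close> at most \<open>2\<close>. So \<open>S\<close> is where \<open>y\<close> dominates \<open>x\<close>.
\<close>

fun edge_weight :: "nat set \<Rightarrow> coord \<Rightarrow> int" where
  "edge_weight S (Xc i) = (if i \<in> S then 1 else 2)"
| "edge_weight S (Yc i) = (if i \<in> S then 2 else 0)"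

text \<open>
  The symbols of the tree operators involve no \<open>y\<close>, hence any monomial in \<open>y\<close> can be put in front of
  them without destroying triangularity.
\<close>

lemma tree_ops:
  assumes "n \<ge> 2" "1 \<le> n1" "n1 < n" "n1 \<le> n2"
    and S: "\<And>c. c \<in> {1..<n} \<Longrightarrow> \<not> {fst (tree_edge n n1 c), snd (tree_edge n n1 c)} \<subseteq> S"
  shows "length (tree_ops n n1 :: ('a::field mat \<times> _) list) = n - 1"
    and "fst ` set (tree_ops n n1) \<subseteq> (sl_set n :: 'a mat set)"
    and "triangular (map snd (tree_ops n n1 :: ('a mat \<times> _) list))"
    and "\<And>v a. a \<in> snd ` set (tree_ops n n1 :: ('a mat \<times> _) list) \<Longrightarrow> Poly_Mapping.lookup a (Yc v) = 0"
    and "\<And>A a m (h :: 'a xy_poly). (A, a) \<in> set (tree_ops n n1) \<Longrightarrow> leads (edge_weight S) h m \<Longrightarrow>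
      leads (edge_weight S) (mat_act n n1 n2 A h) (m + a)"
proof -
  let ?ij = "\<lambda>c. tree_edge n n1 c"
  have range: "fst (?ij c) \<in> {1..n}" "snd (?ij c) \<in> {1..n}" "fst (?ij c) > n1" "snd (?ij c) \<le> n1"
    if "c \<in> {1..<n}" for c
    using that assms by (auto simp: tree_edge_def)
  have set: "set (tree_ops n n1 :: ('a mat \<times> _) list) =
      (\<lambda>c. (mat_unit n (fst (?ij c)) (snd (?ij c)), x_pair (?ij c))) ` {1..<n}"
  proof -
    have "set ([2..<n] @ [1]) = {1..<n}" using assms(1) by auto
    then show ?thesis unfolding tree_ops_def set_map by (simp add: Let_def)
  qed
  show "length (tree_ops n n1 :: ('a mat \<times> _) list) = n - 1"
    using assms(1) by (simp add: tree_ops_def)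
  show "fst ` set (tree_ops n n1) \<subseteq> (sl_set n :: 'a mat set)"
  proof
    fix A :: "'a mat" assume "A \<in> fst ` set (tree_ops n n1)"
    then obtain c where c: "c \<in> {1..<n}" "A = mat_unit n (fst (?ij c)) (snd (?ij c))"
      unfolding set by auto
    show "A \<in> sl_set n" unfolding c(2) using range[OF c(1)] by (intro mat_unit_in_sl_set) auto
  qed
  have "triangular (map (\<lambda>c. x_pair (?ij c)) [2..<n] @ [x_pair (?ij 1)])"
  proof (rule triangular_append_single[where v = Xc])
    show "x_pair (?ij 1) \<noteq> 0"
    proof
      assume "x_pair (?ij 1) = 0"
      then have "Poly_Mapping.lookup (x_pair (?ij 1)) (Xc n) = 0" by simp
      then show False using assms(2) by (simp add: x_pair_def tree_edge_def lookup_add)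
    qed
  qed (use assms in \<open>auto simp: x_pair_def tree_edge_def lookup_add lookup_single when_def\<close>)
  then show "triangular (map snd (tree_ops n n1 :: ('a mat \<times> _) list))"
    by (simp add: tree_ops_def Let_def o_def)
  show "Poly_Mapping.lookup a (Yc v) = 0"
    if "a \<in> snd ` set (tree_ops n n1 :: ('a mat \<times> _) list)" for v a
    using that unfolding set by (auto simp: x_pair_def lookup_add lookup_single)
  show "leads (edge_weight S) (mat_act n n1 n2 A h) (m + a)"
    if "(A, a) \<in> set (tree_ops n n1)" "leads (edge_weight S) h m" for A a m and h :: "'a xy_poly"
  proof -
    from that(1) obtain c where "c \<in> {1..<n}" "(A, a) = (mat_unit n (fst (?ij c)) (snd (?ij c)), x_pair (?ij c))"
      unfolding set by (rule imageE)
    then have c: "c \<in> {1..<n}" "A = mat_unit n (fst (?ij c)) (snd (?ij c))" "a = x_pair (?ij c)"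
      by auto
    have "mat_act n n1 n2 A h = E_op n1 n2 (fst (?ij c)) (snd (?ij c)) h"
      unfolding c(2) using range[OF c(1)] by (intro mat_act_mat_unit) auto
    moreover have "leads (edge_weight S) (E_op n1 n2 (fst (?ij c)) (snd (?ij c)) h) (m + a)"
      unfolding c(3) x_pair_def using range[OF c(1)] S[OF c(1)] assms(4) that(2)
      by (intro leads_E_op_x_pair) auto
    ultimately show ?thesis by simp
  qed
qed

lemma GKdim_H_ge_tree:
  fixes H :: "'a::field_char_0 xy_poly set"
  assumes n: "n \<ge> 2" "1 \<le> n1" "n1 < n" "n1 \<le> n2"
    and irr: "sl_mod.irreducible_module n n1 n2 H" and H: "H = H_space n n1 n2 l1 l2"
  shows "ereal (real (n - 1)) \<le> sl_mod.GKdim n n1 n2 H"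
  using GKdim_H_ge_length[OF irr H tree_ops(2,3,5)[OF n, of "{}"]] tree_ops(1)[OF n, of "{}", where ?'a = 'a]
  by simp

text \<open>
  The additional operator is \<open>E\<^sub>p\<^sub>q\<close> for an edge with \<open>q \<le> n\<^sub>2 < p\<close> that is not in the tree. If \<open>n\<^sub>1 < n\<^sub>2\<close>, the
  edge \<open>(n, n\<^sub>2)\<close> qualifies, since its end points both exceed \<open>n\<^sub>1\<close>. If \<open>n\<^sub>1 = n\<^sub>2\<close>, one needs an edge
  between \<open>{1..n\<^sub>1}\<close> and its complement that avoids the two centres \<open>1\<close> and \<open>n\<close>; the bounds on \<open>n\<^sub>1\<close> say
  that both parts have a second vertex, and \<open>(n\<^sub>1 + 1, 2)\<close> is such an edge.
\<close>

lemma GKdim_H_ge_tree_plus_edge: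
  fixes H :: "'a::field_char_0 xy_poly set"
  assumes n: "1 \<le> n1" "n1 \<le> n2" "n2 < n" and cases: "n1 < n2 \<or> 2 \<le> n1 \<and> n1 + 2 \<le> n"
    and irr: "sl_mod.irreducible_module n n1 n2 H" and H: "H = H_space n n1 n2 l1 l2"
  shows "ereal (real n) \<le> sl_mod.GKdim n n1 n2 H"
proof -
  define p where "p = (if n1 < n2 then n else n1 + 1)"
  define q where "q = (if n1 < n2 then n2 else 2)"
  have pq: "q \<le> n2" "n2 < p" "p \<in> {1..n}" "q \<in> {1..n}" "p \<noteq> q"
    using n cases by (auto simp: p_def q_def)
  let ?w = "edge_weight {p, q}"
  have S: "\<not> {fst (tree_edge n n1 c), snd (tree_edge n n1 c)} \<subseteq> {p, q}" if "c \<in> {1..<n}" for c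
    using that n cases by (auto simp: tree_edge_def p_def q_def split: if_splits)
  have n': "n \<ge> 2" "1 \<le> n1" "n1 < n" "n1 \<le> n2" using n by auto
  note tree = tree_ops[OF n' S, where ?'a = 'a]
  let ?ps = "(mat_unit n p q, y_pair (p, q)) # tree_ops n n1 :: ('a mat \<times> _) list"
  have "ereal (real (length ?ps)) \<le> sl_mod.GKdim n n1 n2 H"
  proof (rule GKdim_H_ge_length[OF irr H, where w = ?w])
    show "fst ` set ?ps \<subseteq> sl_set n"
      using tree(2) mat_unit_in_sl_set[OF pq(3-5)] by auto
    have "Poly_Mapping.lookup (y_pair (p, q)) (Yc q) \<noteq> 0" by (simp add: y_pair_def lookup_add)
    then show "triangular (map snd ?ps)" using tree(3,4) by auto
    fix A :: "'a mat" and a m and h :: "'a xy_poly"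
    assume Aa: "(A, a) \<in> set ?ps" and h: "leads ?w h m"
    show "leads ?w (mat_act n n1 n2 A h) (m + a)"
    proof (cases "(A, a) \<in> set (tree_ops n n1)")
      case True
      show ?thesis by (rule tree_ops(5)[OF n' S True h])
    next
      case False
      then have "A = mat_unit n p q" "a = y_pair (p, q)" using Aa by auto
      then show ?thesis
        using leads_E_op_y_pair[OF pq(1,2) n(2) _ _ h] by (simp add: mat_act_mat_unit[OF pq(3,4)] y_pair_def)
    qed
  qed
  moreover have "length ?ps = n" using tree(1) n' by simp
  ultimately show ?thesis by (simp only:)
qed

text \<open>
  The first grading expresses the exponent of \<open>x\<^sub>1\<close> in terms of the others.
\<close>

lemma B_monomials_lookup_Xc_1_eq:
  assumes m: "m \<in> B_monomials n n1 n2 l1 l2" "m' \<in> B_monomials n n1 n2 l1 l2" and n1: "1 \<le> n1" "n1 \<le> n"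
    and eq: "\<And>i. i \<in> {2..n} \<Longrightarrow> Poly_Mapping.lookup m (Xc i) = Poly_Mapping.lookup m' (Xc i)"
  shows "Poly_Mapping.lookup m (Xc 1) = Poly_Mapping.lookup m' (Xc 1)"
proof -
  have split: "(\<Sum>i\<in>{1..n1}. int (Poly_Mapping.lookup k (Xc i))) =
      int (Poly_Mapping.lookup k (Xc 1)) + (\<Sum>i\<in>{2..n1}. int (Poly_Mapping.lookup k (Xc i)))"
    for k :: "coord \<Rightarrow>\<^sub>0 nat"
    using n1(1) by (simp add: sum.atLeast_Suc_atMost numeral_2_eq_2)
  have "(\<Sum>r\<in>{n1+1..n}. int (Poly_Mapping.lookup m (Xc r))) = (\<Sum>r\<in>{n1+1..n}. int (Poly_Mapping.lookup m' (Xc r)))"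
    "(\<Sum>i\<in>{2..n1}. int (Poly_Mapping.lookup m (Xc i))) = (\<Sum>i\<in>{2..n1}. int (Poly_Mapping.lookup m' (Xc i)))"
    using n1 by (auto intro!: sum.cong simp: eq)
  moreover have
    "(\<Sum>r\<in>{n1+1..n}. int (Poly_Mapping.lookup m (Xc r))) - (\<Sum>i\<in>{1..n1}. int (Poly_Mapping.lookup m (Xc i))) = l1"
    "(\<Sum>r\<in>{n1+1..n}. int (Poly_Mapping.lookup m' (Xc r))) - (\<Sum>i\<in>{1..n1}. int (Poly_Mapping.lookup m' (Xc i))) = l1"
    using m by (simp_all add: B_monomials_def)
  ultimately show ?thesis using split[of m] split[of m'] by linarith
qed

lemma lookup_le_sum:
  "finite I \<Longrightarrow> i \<in> I \<Longrightarrow> int (Poly_Mapping.lookup m (v i)) \<le> (\<Sum>i\<in>I. int (Poly_Mapping.lookup m (v i)))"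
  by (rule member_le_sum) auto

lemma card_image_coord:
  "card (Xc ` I) = card I" "card (Yc ` I) = card I"
  by (auto intro!: card_image inj_onI)

text \<open>
  Of the \<open>n\<close> exponents of the \<open>x\<close>-part, the first grading leaves \<open>n - 1\<close> free.
\<close>

lemma GKdim_H_le_if_y_exponents_bounded:
  fixes H :: "'a::field_char_0 xy_poly set"
  assumes n: "1 \<le> n1" "n1 \<le> n"
    and irr: "sl_mod.irreducible_module n n1 n2 H"
    and Z: "Z \<subseteq> B_monomials n n1 n2 l1 l2"
    and sep: "\<And>f. f \<in> H \<Longrightarrow> f \<noteq> 0 \<Longrightarrow> \<exists>m\<in>Poly_Mapping.keys f. m \<in> Z"
    and bounded: "\<And>m i. m \<in> Z \<Longrightarrow> i \<in> {1..n} \<Longrightarrow> Poly_Mapping.lookup m (Yc i) \<le> L"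
  shows "sl_mod.GKdim n n1 n2 H \<le> ereal (real (n - 1))"
proof -
  have "sl_mod.GKdim n n1 n2 H \<le> ereal (real (card (Xc ` {2..n})))"
  proof (rule GKdim_H_le_card[OF irr _ _ sep])
    show "finite (Xc ` {2..n})" "finite (Yc ` {1..n})" by auto
    fix m c assume "m \<in> Z" "c \<in> Yc ` {1..n}"
    then show "Poly_Mapping.lookup m c \<le> L" using bounded by auto
  next
    fix m m' assume m: "m \<in> Z" "m' \<in> Z"
      and eq: "\<And>c. c \<in> Xc ` {2..n} \<union> Yc ` {1..n} \<Longrightarrow> Poly_Mapping.lookup m c = Poly_Mapping.lookup m' c"
    have B: "m \<in> B_monomials n n1 n2 l1 l2" "m' \<in> B_monomials n n1 n2 l1 l2" using m Z by auto
    show "m = m'"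
    proof (rule B_monomials_eqI[OF B])
      fix i assume "i \<in> {1..n}"
      then consider "i = 1" | "i \<in> {2..n}" by force
      then show "Poly_Mapping.lookup m (Xc i) = Poly_Mapping.lookup m' (Xc i)"
        using B_monomials_lookup_Xc_1_eq[OF B n] eq by cases auto
    qed (use eq in auto)
  qed
  then show ?thesis by (simp add: card_image_coord)
qed

lemma GKdim_H_le_if_n2_eq_n:
  fixes H :: "'a::field_char_0 xy_poly set"
  assumes n: "1 \<le> n1" "n1 \<le> n" "n2 = n"
    and irr: "sl_mod.irreducible_module n n1 n2 H" and H: "H = H_space n n1 n2 l1 l2"
  shows "sl_mod.GKdim n n1 n2 H \<le> ereal (real (n - 1))"
proof (rule GKdim_H_le_if_y_exponents_bounded[OF n(1,2) irr order_refl])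
  fix f assume "f \<in> H" "f \<noteq> 0"
  then show "\<exists>m\<in>Poly_Mapping.keys f. m \<in> B_monomials n n1 n2 l1 l2"
    using keys_B_space[of f n n1 n2 l1 l2] by (auto simp: H H_space_def) (metis all_not_in_conv keys_eq_empty subsetD)
next
  fix m i assume "m \<in> B_monomials n n1 n2 l1 l2" "i \<in> {1..n}"
  then show "Poly_Mapping.lookup m (Yc i) \<le> nat l2"
    using lookup_le_sum[of "{1..n}" i m Yc] n(3) by (simp add: B_monomials_def)
qed

text \<open>
  Here \<open>\<D> = - x\<^sub>1 \<partial>\<^sub>y\<^sub>1 - \<Sum>\<^sub>s y\<^sub>s \<partial>\<^sub>x\<^sub>s\<close> with \<open>s \<ge> 2\<close>, and elements of its kernel are determined by their
  restriction to \<open>y\<^sub>1 = 0\<close>.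
\<close>

lemma GKdim_H_le_if_n1_n2_eq_1:
  fixes H :: "'a::field_char_0 xy_poly set"
  assumes n: "1 \<le> n"
    and irr: "sl_mod.irreducible_module n 1 1 H" and H: "H = H_space n 1 1 l1 l2"
  shows "sl_mod.GKdim n 1 1 H \<le> ereal (real (n - 1))"
proof (rule GKdim_H_le_if_y_exponents_bounded[OF order_refl n irr])
  let ?Z = "{m \<in> B_monomials n 1 1 l1 l2. Poly_Mapping.lookup m (Yc 1) = 0}"
  show "?Z \<subseteq> B_monomials n 1 1 l1 l2" by auto
  fix f assume f: "f \<in> H" "f \<noteq> 0"
  have "\<exists>m\<in>Poly_Mapping.keys f. Poly_Mapping.lookup m (Yc 1) = 0"
  proof (rule kernel_exponent_zero[OF _ _ f(2)])
    let ?R = "\<Sum>s\<in>{2..n}. mul_y s (d_x s f)"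
    have "- (- (pvar (Xc 1) * pdiff (Yc 1) f) - ?R) = 0"
      using f(1) by (simp add: H H_space_def D_op_def numeral_2_eq_2)
    then show "pvar (Xc 1) * pdiff (Yc 1) f + ?R = 0"
      by (simp add: algebra_simps)
    fix N assume f': "wt_le (\<lambda>c. if c = Yc 1 then - 1 else 0) N f"
    show "wt_le (\<lambda>c. if c = Yc 1 then - 1 else 0) N ?R"
    proof (rule wt_le_sum)
      fix s assume "s \<in> {2..n}"
      then show "wt_le (\<lambda>c. if c = Yc 1 then - 1 else 0) N (mul_y s (d_x s f))"
        using wt_le_pvar[OF wt_le_pdiff[OF f', of "Xc s"], of "Yc s"] by simp
    qed
  qed simp
  then show "\<exists>m\<in>Poly_Mapping.keys f. m \<in> ?Z"
    using f(1) keys_B_space[of f n 1 1 l1 l2] by (auto simp: H H_space_def)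
next
  fix m i assume m: "m \<in> {m \<in> B_monomials n 1 1 l1 l2. Poly_Mapping.lookup m (Yc 1) = 0}" and i: "i \<in> {1..n}"
  show "Poly_Mapping.lookup m (Yc i) \<le> nat (- l2)"
  proof (cases "i = 1")
    case False
    \<comment> \<open>The exponent of \<open>y\<^sub>1\<close> vanishes, so the second grading only sees the other \<open>y\<close>-exponents.\<close>
    have "(\<Sum>i\<in>{2..n}. int (Poly_Mapping.lookup m (Yc i))) = - l2"
      using m by (auto simp: B_monomials_def numeral_2_eq_2)
    then have "int (Poly_Mapping.lookup m (Yc i)) \<le> - l2"
      using lookup_le_sum[of "{2..n}" i m Yc] i False by auto
    then show ?thesis by linarith
  qed (use m in simp)
qed

text \<open>
  Here \<open>\<D> = - \<Sum>\<^sub>i x\<^sub>i \<partial>\<^sub>y\<^sub>i - y\<^sub>n \<partial>\<^sub>x\<^sub>n\<close> with \<open>i < n\<close>, and elements of its kernel are determined by their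
  restriction to \<open>x\<^sub>n = 0\<close>. There the first grading bounds the \<open>x\<close>-exponents, and the second one
  expresses the exponent of \<open>y\<^sub>n\<close> in terms of the other \<open>n - 1\<close> exponents of \<open>y\<close>-variables.
\<close>

lemma GKdim_H_le_if_n1_n2_eq_n_minus_1:
  fixes H :: "'a::field_char_0 xy_poly set"
  assumes n: "2 \<le> n"
    and irr: "sl_mod.irreducible_module n (n - 1) (n - 1) H" and H: "H = H_space n (n - 1) (n - 1) l1 l2"
  shows "sl_mod.GKdim n (n - 1) (n - 1) H \<le> ereal (real (n - 1))"
proof -
  have Suc: "Suc (n - Suc 0) = n" "{n..n - Suc 0} = {}" using n by auto
  let ?B = "B_monomials n (n - 1) (n - 1) l1 l2"
  let ?Z = "{m \<in> ?B. Poly_Mapping.lookup m (Xc n) = 0}"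
  have "sl_mod.GKdim n (n - 1) (n - 1) H \<le> ereal (real (card (Yc ` {1..n-1})))"
  proof (rule GKdim_H_le_card[OF irr])
    show "finite (Yc ` {1..n-1})" "finite (Xc ` {1..n})" by auto
    fix f assume f: "f \<in> H" "f \<noteq> 0"
    have "\<exists>m\<in>Poly_Mapping.keys f. Poly_Mapping.lookup m (Xc n) = 0"
    proof (rule kernel_exponent_zero[OF _ _ f(2)])
      let ?R = "\<Sum>i\<in>{1..n-1}. mul_x i (d_y i f)"
      have "- (- ?R - pvar (Yc n) * pdiff (Xc n) f) = 0"
        using f(1) by (simp add: H H_space_def D_op_def Suc)
      then show "pvar (Yc n) * pdiff (Xc n) f + ?R = 0"
        by (simp add: algebra_simps)
      fix N assume f': "wt_le (\<lambda>c. if c = Xc n then - 1 else 0) N f"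
      show "wt_le (\<lambda>c. if c = Xc n then - 1 else 0) N ?R"
      proof (rule wt_le_sum)
        fix i assume "i \<in> {1..n-1}"
        then have "i \<noteq> n" by auto
        then show "wt_le (\<lambda>c. if c = Xc n then - 1 else 0) N (mul_x i (d_y i f))"
          using wt_le_pvar[OF wt_le_pdiff[OF f', of "Yc i"], of "Xc i"] by simp
      qed
    qed simp
    then show "\<exists>m\<in>Poly_Mapping.keys f. m \<in> ?Z"
      using f(1) keys_B_space[of f n "n - 1" "n - 1" l1 l2] by (auto simp: H H_space_def)
  next
    fix m c assume m: "m \<in> ?Z" and c: "c \<in> Xc ` {1..n}"
    then obtain i where i: "c = Xc i" "i \<in> {1..n}" by auto
    show "Poly_Mapping.lookup m c \<le> nat (- l1)"
    proof (cases "i = n")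
      case False
      have "(\<Sum>i\<in>{1..n-1}. int (Poly_Mapping.lookup m (Xc i))) = - l1"
        using m by (auto simp: B_monomials_def Suc)
      then have "int (Poly_Mapping.lookup m (Xc i)) \<le> - l1"
        using lookup_le_sum[of "{1..n-1}" i m Xc] i False by auto
      then show ?thesis unfolding i(1) by linarith
    qed (use m i in simp)
  next
    fix m m' assume m: "m \<in> ?Z" "m' \<in> ?Z"
      and eq: "\<And>c. c \<in> Yc ` {1..n-1} \<union> Xc ` {1..n} \<Longrightarrow> Poly_Mapping.lookup m c = Poly_Mapping.lookup m' c"
    have "(\<Sum>i\<in>{1..n-1}. int (Poly_Mapping.lookup m (Yc i))) = (\<Sum>i\<in>{1..n-1}. int (Poly_Mapping.lookup m' (Yc i)))"
      by (intro sum.cong) (auto simp: eq)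
    then have Yn: "Poly_Mapping.lookup m (Yc n) = Poly_Mapping.lookup m' (Yc n)"
      using m by (simp add: B_monomials_def Suc)
    show "m = m'"
    proof (rule B_monomials_eqI)
      fix i assume "i \<in> {1..n}"
      then show "Poly_Mapping.lookup m (Yc i) = Poly_Mapping.lookup m' (Yc i)"
        using Yn eq[of "Yc i"] by (cases "i = n") auto
    qed (use m eq in auto)
  qed
  then show ?thesis by (simp add: card_image_coord)
qed

lemma GKdim_H_le_0_if_n1_n2_eq_n:
  fixes H :: "'a::field_char_0 xy_poly set"
  assumes irr: "sl_mod.irreducible_module n n n H" and H: "H = H_space n n n l1 l2"
  shows "sl_mod.GKdim n n n H \<le> 0"
proof -
  let ?L = "nat (- l1) + nat l2"
  have "sl_mod.GKdim n n n H \<le> ereal (real (card ({} :: coord set)))"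
  proof (rule GKdim_H_le_card[OF irr])
    show "finite ({} :: coord set)" "finite (Xc ` {1..n} \<union> Yc ` {1..n})" by auto
    fix f assume "f \<in> H" "f \<noteq> 0"
    then show "\<exists>m\<in>Poly_Mapping.keys f. m \<in> B_monomials n n n l1 l2"
      using keys_B_space[of f n n n l1 l2] by (auto simp: H H_space_def) (metis all_not_in_conv keys_eq_empty subsetD)
  next
    fix m c assume "m \<in> B_monomials n n n l1 l2" "c \<in> Xc ` {1..n} \<union> Yc ` {1..n}"
    then show "Poly_Mapping.lookup m c \<le> ?L"
      using lookup_le_sum[of "{1..n}" _ m Xc] lookup_le_sum[of "{1..n}" _ m Yc]
      by (fastforce simp: B_monomials_def)
  next
    fix m m' assume "m \<in> B_monomials n n n l1 l2" "m' \<in> B_monomials n n n l1 l2"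
      "\<And>c. c \<in> {} \<union> (Xc ` {1..n} \<union> Yc ` {1..n}) \<Longrightarrow> Poly_Mapping.lookup m c = Poly_Mapping.lookup m' c"
    then show "m = m'" by (intro B_monomials_eqI) auto
  qed
  then show ?thesis by (simp add: zero_ereal_def)
qed


section \<open>The modules of minimal Gelfand-Kirillov dimension\<close>

theorem corollary1p1:
  fixes n n1 n2 :: nat and l1 l2 :: int
    and H :: "'a::field_char_0 xy_poly set"
  assumes "n \<ge> 2"
    and "n1 \<in> {1..n}" and "n2 \<in> {1..n}" and "n1 \<le> n2"
    and "H = H_space n n1 n2 l1 l2"
    and "sl_mod.irreducible_module n n1 n2 H"
  shows "sl_mod.GKdim n n1 n2 H = ereal (real n - 1) \<longleftrightarrow>
    (n1 < n2 \<and> n2 = n) \<or> (n1 = 1 \<and> n2 = 1) \<or> (n1 = n - 1 \<and> n2 = n - 1)"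
    (is "?GK = _ \<longleftrightarrow> ?minimal")
proof
  assume ?minimal
  then have "n1 < n" using assms(1) by auto
  then have "ereal (real (n - 1)) \<le> ?GK"
    using assms by (intro GKdim_H_ge_tree) auto
  moreover have "?GK \<le> ereal (real (n - 1))"
    using \<open>?minimal\<close> assms GKdim_H_le_if_n2_eq_n[of n1 n n2 H l1 l2] GKdim_H_le_if_n1_n2_eq_1[of n H l1 l2]
      GKdim_H_le_if_n1_n2_eq_n_minus_1[of n H l1 l2]
    by auto
  ultimately have "?GK = ereal (real (n - 1))" by (rule order_antisym[rotated])
  then show "?GK = ereal (real n - 1)" using assms(1) by (simp add: of_nat_diff)
next
  assume GK: "?GK = ereal (real n - 1)"
  show ?minimal
  proof (rule ccontr)
    assume not: "\<not> ?minimal"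
    show False
    proof (cases "n1 = n")
      case True
      then have "?GK \<le> 0" using GKdim_H_le_0_if_n1_n2_eq_n[of n H l1 l2] assms by auto
      then show False using GK assms(1) by simp
    next
      case False
      then have "n2 < n" "n1 < n2 \<or> 2 \<le> n1 \<and> n1 + 2 \<le> n" using not assms by auto
      then have "ereal (real n) \<le> ?GK"
        using assms by (intro GKdim_H_ge_tree_plus_edge) auto
      then show False using GK by simp
    qed
  qed
qed

end
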